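(* Let $\mathbb{K}$ be an infinite field, let $d$ be a nonnegative integer, and let $p=(\{\theta_i\}_{i=0}^d;\{\theta^*_i\}_{i=0}^d)$ be a sequence of scalars taken from $\mathbb{K}$ that satisfies: (i) $\theta_i\neq\theta_j$ and $\theta^*_i\neq\theta^*_j$ if $i\neq j$ $(0\le i,j\le d)$; (ii) the expressions $\frac{\theta_{i-2}-\theta_{i+1}}{\theta_{i-1}-\theta_i}$ and $\frac{\theta^*_{i-2}-\theta^*_{i+1}}{\theta^*_{i-1}-\theta^*_i}$ are equal and independent of $i$ for $2\le i\le d-1$. Let $T=T(p,\mathbb{K})$ be the associated $\mathbb{K}$-algebra. Assume that, for every sequence $\{\zeta_i\}_{i=0}^d$ of scalars taken from $\mathbb{K}$ such that $$\zeta_0=1,\qquad \zeta_d\neq 0,\qquad 0\neq\sum_{i=0}^d\eta_{d-i}(\theta_0)\,\eta^*_{d-i}(\theta^*_0)\,\zeta_i,$$ there exists a sharp tridiagonal system over $\mathbb{K}$ that has parameter array $(\{\theta_i\}_{i=0}^d;\{\theta^*_i\}_{i=0}^d;\{\zeta_i\}_{i=0}^d)$. Then the $\mathbb{K}$-algebra homomorphism $\mu:\mathbb{K}[x_1,\ldots,x_d]\to e^*_0Te^*_0$ that sends $x_i\mapsto e^*_0\tau_i(a)e^*_0$ for $1\le i\le d$ is an isomorphism.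
   Context: Polynomials. Given scalars $(\{\theta_i\}_{i=0}^d;\{\theta^*_i\}_{i=0}^d)$ in a field $\mathbb{K}$, for $0\le i\le d$ define the following polynomials in $\mathbb{K}[\lambda]$ (empty products equal $1$): $\tau_i=(\lambda-\theta_0)(\lambda-\theta_1)\cdots(\lambda-\theta_{i-1})$, $\eta_i=(\lambda-\theta_d)(\lambda-\theta_{d-1})\cdots(\lambda-\theta_{d-i+1})$, $\eta^*_i=(\lambda-\theta^*_d)(\lambda-\theta^*_{d-1})\cdots(\lambda-\theta^*_{d-i+1})$. The algebra $T(p,\mathbb{K})$. For $p=(\{\theta_i\}_{i=0}^d;\{\theta^*_i\}_{i=0}^d)$ satisfying (i), (ii) of the claim, $T=T(p,\mathbb{K})$ is the associative $\mathbb{K}$-algebra with $1$ defined by generators $a$, $\{e_i\}_{i=0}^d$, $a^*$, $\{e^*_i\}_{i=0}^d$ and relations - $e_ie_j=\delta_{i,j}e_i$, $e^*_ie^*_j=\delta_{i,j}e^*_i$ $(0\le i,j\le d)$; - $1=\sum_{i=0}^d e_i$, $1=\sum_{i=0}^d e^*_i$; - $a=\sum_{i=0}^d\theta_ie_i$, $a^*=\sum_{i=0}^d\theta^*_ie^*_i$; - $e^*_ia^ke^*_j=0$ if $k<|i-j|$ $(0\le i,j,k\le d)$; - $e_i(a^* )^ke_j=0$ if $k<|i-j|$ $(0\le i,j,k\le d)$. (Here $a^*$, $e_i^*$ are just names of generators; no involution is intended.) The set $e^*_0Te^*_0$ is a $\mathbb{K}$-algebra with multiplicative identity $e^*_0$.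 It is known that $e^*_0Te^*_0$ is commutative and generated by $e^*_0\tau_i(a)e^*_0$ $(1\le i\le d)$; hence there is a (unique, surjective) $\mathbb{K}$-algebra homomorphism $\mu$ from the commutative polynomial algebra $\mathbb{K}[x_1,\ldots,x_d]$ to $e^*_0Te^*_0$ with $x_i\mapsto e^*_0\tau_i(a)e^*_0$. Tridiagonal pairs and systems. Let $V$ be a vector space over $\mathbb{K}$ of finite positive dimension. A tridiagonal pair on $V$ is an ordered pair of linear transformations $A:V\to V$, $A^*:V\to V$ such that: (1) each of $A,A^*$ is diagonalizable over $\mathbb{K}$ ($V$ is spanned by the eigenspaces); (2) there is an ordering $\{V_i\}_{i=0}^d$ of the eigenspaces of $A$ such that $A^*V_i\subseteq V_{i-1}+V_i+V_{i+1}$ $(0\le i\le d)$, where $V_{-1}=0=V_{d+1}$; (3) there is an ordering $\{V^*_i\}_{i=0}^\delta$ of the eigenspaces of $A^*$ such that $AV^*_i\subseteq V^*_{i-1}+V^*_i+V^*_{i+1}$ $(0\le i\le\delta)$, where $V^*_{-1}=0=V^*_{\delta+1}$; (4) there is no subspace $W$ of $V$ with $AW\subseteq W$, $A^*W\subseteq W$, $W\neq0$, $W\neq V$. ($A^*$ is not the conjugate transpose of $A$.) It is known that $d=\delta$. Orderings as in (2), (3) are called standard. The primitive idempotent of a diagonalizable map for an eigenspace is the projection onto that eigenspace which vanishes on the other eigenspaces; an ordering of primitive idempotents is standard if the corresponding ordering of eigenspaces is standard. A tridiagonal system on $V$ (over $\mathbb{K}$) is a sequence $\Phi=(A;\{E_i\}_{i=0}^d;A^*;\{E^*_i\}_{i=0}^d)$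 where $A,A^*$ is a tridiagonal pair on $V$, $\{E_i\}_{i=0}^d$ is a standard ordering of the primitive idempotents of $A$, and $\{E^*_i\}_{i=0}^d$ is a standard ordering of the primitive idempotents of $A^*$. Its eigenvalue sequence $\{\theta_i\}_{i=0}^d$ (resp. dual eigenvalue sequence $\{\theta^*_i\}_{i=0}^d$) consists of the eigenvalues $\theta_i$ of $A$ on $E_iV$ (resp. $\theta^*_i$ of $A^*$ on $E^*_iV$). $\Phi$ is sharp if $\dim E_0V=1$ (it is known that $\dim E_0V=\dim E^*_0V$). For sharp $\Phi$ it is known that for $0\le i\le d$ there is a unique $\zeta_i\in\mathbb{K}$ with $$E^*_0\tau_i(A)E^*_0=\frac{\zeta_iE^*_0}{(\theta^*_0-\theta^*_1)(\theta^*_0-\theta^*_2)\cdots(\theta^*_0-\theta^*_i)};$$ $\{\zeta_i\}_{i=0}^d$ is the split sequence of $\Phi$, and the parameter array of $\Phi$ is $(\{\theta_i\}_{i=0}^d;\{\theta^*_i\}_{i=0}^d;\{\zeta_i\}_{i=0}^d)$. *)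

theory Defs
  imports
    "HOL-Computational_Algebra.Polynomial"
    "HOL-Library.Poly_Mapping"
    "HOL-Library.Function_Algebras"
    "HOL-Algebra.QuotRing"
    "HOL-Algebra.Module"
begin

section \<open>The polynomials \<open>\<tau>\<^sub>i\<close> and \<open>\<eta>\<^sub>i\<close>\<close>

text \<open>
  A sequence of scalars indexed by \<open>0, \<dots>, d\<close> is a function on \<open>nat\<close>;
  only its values at \<open>0, \<dots>, d\<close> are ever used.
\<close>

definition tau :: "(nat \<Rightarrow> 'k::field) \<Rightarrow> nat \<Rightarrow> 'k poly" where
  "tau \<theta> i = (\<Prod>h<i. [:- \<theta> h, 1:])"

definition eta :: "nat \<Rightarrow> (nat \<Rightarrow> 'k::field) \<Rightarrow> nat \<Rightarrow> 'k poly" where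
  "eta d \<theta> i = (\<Prod>h<i. [:- \<theta> (d - h), 1:])"


section \<open>Associative algebras\<close>

text \<open>
  An associative unital algebra over the field \<open>'k\<close>, not necessarily commutative, is
  represented by a record of type \<open>('k, 'a) module\<close>.
\<close>

definition algebra_hom ::
    "('k, 'a, 'm) module_scheme \<Rightarrow> ('k, 'b, 'n) module_scheme \<Rightarrow> ('a \<Rightarrow> 'b) set" where
  "algebra_hom A B =
     {h \<in> ring_hom A B. \<forall>c. \<forall>x\<in>carrier A. h (c \<odot>\<^bsub>A\<^esub> x) = c \<odot>\<^bsub>B\<^esub> h x}"

definition algebra_iso ::
    "('k, 'a, 'm) module_scheme \<Rightarrow> ('k, 'b, 'n) module_scheme \<Rightarrow> ('a \<Rightarrow> 'b) set" where
  "algebra_iso A B = {h \<in> algebra_hom A B. bij_betw h (carrier A) (carrier B)}"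

definition algebra_eval :: "('k::field, 'a, 'm) module_scheme \<Rightarrow> 'k poly \<Rightarrow> 'a \<Rightarrow> 'a" where
  "algebra_eval A f x =
     (\<Oplus>\<^bsub>A\<^esub>i\<in>{..degree f}. coeff f i \<odot>\<^bsub>A\<^esub> (x [^]\<^bsub>A\<^esub> i))"

definition quotient_algebra :: "('k, 'a, 'm) module_scheme \<Rightarrow> 'a set \<Rightarrow> ('k, 'a set) module" where
  "quotient_algebra A I =
     ring.extend (A Quot I) \<lparr>smult = (\<lambda>c X. \<Union>x\<in>X. I +>\<^bsub>A\<^esub> (c \<odot>\<^bsub>A\<^esub> x))\<rparr>"

text \<open>For an idempotent \<open>e\<close> of \<open>A\<close>, the algebra \<open>eAe\<close> with identity \<open>e\<close>.\<close>

definition corner_algebra :: "('k, 'a) module \<Rightarrow> 'a \<Rightarrow> ('k, 'a) module" where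
  "corner_algebra A e =
     A\<lparr>carrier := {e \<otimes>\<^bsub>A\<^esub> x \<otimes>\<^bsub>A\<^esub> e |x. x \<in> carrier A}, one := e\<rparr>"

text \<open>
  The monoid algebra of a submonoid \<open>M\<close> of an additively written monoid. It specializes to free
  algebras (words under concatenation) and to commutative polynomial algebras (exponent vectors).
\<close>

definition monoid_algebra :: "'m::monoid_add set \<Rightarrow> ('k::field, 'm \<Rightarrow>\<^sub>0 'k) module" where
  "monoid_algebra M =
     \<lparr>carrier = {f. Poly_Mapping.keys f \<subseteq> M}, mult = (*), one = 1, zero = 0, add = (+),
      smult = (\<lambda>c f. Poly_Mapping.map ((*) c) f)\<rparr>"

instantiation list :: (type) monoid_add
begin

definition zero_list :: "'a list" where "0 = []"
definition plus_list :: "'a list \<Rightarrow> 'a list \<Rightarrow> 'a list" where "xs + ys = xs @ ys"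

instance by standard (simp_all add: zero_list_def plus_list_def)

end

definition free_algebra :: "'g set \<Rightarrow> ('k::field, 'g list \<Rightarrow>\<^sub>0 'k) module" where
  "free_algebra X = monoid_algebra (lists X)"

definition poly_algebra :: "nat set \<Rightarrow> ('k::field, (nat \<Rightarrow>\<^sub>0 nat) \<Rightarrow>\<^sub>0 'k) module" where
  "poly_algebra X = monoid_algebra {m. Poly_Mapping.keys m \<subseteq> X}"

definition poly_var :: "nat \<Rightarrow> (nat \<Rightarrow>\<^sub>0 nat) \<Rightarrow>\<^sub>0 'k::field" where
  "poly_var i = Poly_Mapping.single (Poly_Mapping.single i 1) 1"


section \<open>The algebra \<open>T(p, K)\<close>\<close>

datatype gen = Gen_a | Gen_e nat | Gen_as | Gen_es nat

definition gens :: "nat \<Rightarrow> gen set" where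
  "gens d = {Gen_a, Gen_as} \<union> Gen_e ` {..d} \<union> Gen_es ` {..d}"

definition fgen :: "gen \<Rightarrow> gen list \<Rightarrow>\<^sub>0 'k::field" where
  "fgen g = Poly_Mapping.single [g] 1"

definition fscalar :: "'k \<Rightarrow> gen list \<Rightarrow>\<^sub>0 'k::field" where
  "fscalar c = Poly_Mapping.single 0 c"

text \<open>A relation \<open>u = v\<close> is encoded by the element \<open>u - v\<close> of the free algebra.\<close>

definition T_relators ::
    "nat \<Rightarrow> (nat \<Rightarrow> 'k::field) \<Rightarrow> (nat \<Rightarrow> 'k) \<Rightarrow> (gen list \<Rightarrow>\<^sub>0 'k) set" where
  "T_relators d \<theta> \<theta>s =
     {fgen (Gen_e i) * fgen (Gen_e j) - (if i = j then fgen (Gen_e i) else 0) |i j. i \<le> d \<and> j \<le> d}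
   \<union> {fgen (Gen_es i) * fgen (Gen_es j) - (if i = j then fgen (Gen_es i) else 0) |i j. i \<le> d \<and> j \<le> d}
   \<union> {1 - (\<Sum>i\<le>d. fgen (Gen_e i)), 1 - (\<Sum>i\<le>d. fgen (Gen_es i))}
   \<union> {fgen Gen_a - (\<Sum>i\<le>d. fscalar (\<theta> i) * fgen (Gen_e i)),
      fgen Gen_as - (\<Sum>i\<le>d. fscalar (\<theta>s i) * fgen (Gen_es i))}
   \<union> {fgen (Gen_es i) * fgen Gen_a ^ k * fgen (Gen_es j) |i j k.
        i \<le> d \<and> j \<le> d \<and> k \<le> d \<and> int k < \<bar>int i - int j\<bar>}
   \<union> {fgen (Gen_e i) * fgen Gen_as ^ k * fgen (Gen_e j) |i j k.
        i \<le> d \<and> j \<le> d \<and> k \<le> d \<and> int k < \<bar>int i - int j\<bar>}"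

definition T_ideal ::
    "nat \<Rightarrow> (nat \<Rightarrow> 'k::field) \<Rightarrow> (nat \<Rightarrow> 'k) \<Rightarrow> (gen list \<Rightarrow>\<^sub>0 'k) set" where
  "T_ideal d \<theta> \<theta>s = Idl\<^bsub>free_algebra (gens d)\<^esub> (T_relators d \<theta> \<theta>s)"

definition T_algebra ::
    "nat \<Rightarrow> (nat \<Rightarrow> 'k::field) \<Rightarrow> (nat \<Rightarrow> 'k) \<Rightarrow> ('k, (gen list \<Rightarrow>\<^sub>0 'k) set) module" where
  "T_algebra d \<theta> \<theta>s = quotient_algebra (free_algebra (gens d)) (T_ideal d \<theta> \<theta>s)"

definition T_gen ::
    "nat \<Rightarrow> (nat \<Rightarrow> 'k::field) \<Rightarrow> (nat \<Rightarrow> 'k) \<Rightarrow> gen \<Rightarrow> (gen list \<Rightarrow>\<^sub>0 'k) set" where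
  "T_gen d \<theta> \<theta>s g = T_ideal d \<theta> \<theta>s +>\<^bsub>free_algebra (gens d)\<^esub> fgen g"


section \<open>Tridiagonal pairs and systems\<close>

text \<open>
  The space \<open>V\<close> is a subspace of an ambient vector space. Linear transformations of \<open>V\<close> are
  functions on the ambient type of which only the restriction to \<open>V\<close> matters.
\<close>

locale ambient_space = vector_space scale
  for scale :: "'a::field \<Rightarrow> 'b::ab_group_add \<Rightarrow> 'b"
begin

definition endo :: "'b set \<Rightarrow> ('b \<Rightarrow> 'b) \<Rightarrow> bool" where
  "endo V f \<longleftrightarrow> (\<forall>v\<in>V. f v \<in> V) \<and> (\<forall>v\<in>V. \<forall>w\<in>V. f (v + w) = f v + f w)
     \<and> (\<forall>c. \<forall>v\<in>V. f (scale c v) = scale c (f v))"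

definition eigenspaces :: "'b set \<Rightarrow> ('b \<Rightarrow> 'b) \<Rightarrow> 'b set set" where
  "eigenspaces V f = {U. \<exists>c. U = {v\<in>V. f v = scale c v} \<and> U \<noteq> {0}}"

definition diagonalizable :: "'b set \<Rightarrow> ('b \<Rightarrow> 'b) \<Rightarrow> bool" where
  "diagonalizable V f \<longleftrightarrow> span (\<Union>(eigenspaces V f)) = V"

text \<open>
  A standard ordering \<open>W\<^sub>0, \<dots>, W\<^sub>d\<close> of the eigenspaces of \<open>f\<close>, relative to the action of \<open>g\<close>.
  The sum \<open>W\<^sub>i\<^sub>-\<^sub>1 + W\<^sub>i + W\<^sub>i\<^sub>+\<^sub>1\<close> is the span of the union; terms with index outside \<open>0, \<dots>, d\<close>
  are zero and are left out.
\<close>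

definition standard_ordering ::
    "'b set \<Rightarrow> ('b \<Rightarrow> 'b) \<Rightarrow> ('b \<Rightarrow> 'b) \<Rightarrow> nat \<Rightarrow> (nat \<Rightarrow> 'b set) \<Rightarrow> bool" where
  "standard_ordering V f g d W \<longleftrightarrow>
     bij_betw W {..d} (eigenspaces V f) \<and>
     (\<forall>i\<le>d. g ` W i \<subseteq> span (\<Union>j\<in>{j. j \<le> d \<and> i \<le> j + 1 \<and> j \<le> i + 1}. W j))"

definition tridiagonal_pair :: "'b set \<Rightarrow> ('b \<Rightarrow> 'b) \<Rightarrow> ('b \<Rightarrow> 'b) \<Rightarrow> bool" where
  "tridiagonal_pair V A As \<longleftrightarrow>
     subspace V \<and> (\<exists>B. finite B \<and> span B = V) \<and> V \<noteq> {0} \<and>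
     endo V A \<and> endo V As \<and>
     diagonalizable V A \<and> diagonalizable V As \<and>
     (\<exists>d W. standard_ordering V A As d W) \<and>
     (\<exists>\<delta> W. standard_ordering V As A \<delta> W) \<and>
     \<not> (\<exists>W. subspace W \<and> W \<subseteq> V \<and> A ` W \<subseteq> W \<and> As ` W \<subseteq> W \<and> W \<noteq> {0} \<and> W \<noteq> V)"

definition primitive_idempotent ::
    "'b set \<Rightarrow> ('b \<Rightarrow> 'b) \<Rightarrow> 'b set \<Rightarrow> ('b \<Rightarrow> 'b) \<Rightarrow> bool" where
  "primitive_idempotent V f U P \<longleftrightarrow>
     endo V P \<and> (\<forall>v\<in>U. P v = v) \<and> (\<forall>U'\<in>eigenspaces V f. U' \<noteq> U \<longrightarrow> (\<forall>v\<in>U'. P v = 0))"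

definition standard_idempotents ::
    "'b set \<Rightarrow> ('b \<Rightarrow> 'b) \<Rightarrow> ('b \<Rightarrow> 'b) \<Rightarrow> nat \<Rightarrow> (nat \<Rightarrow> 'b \<Rightarrow> 'b) \<Rightarrow> bool" where
  "standard_idempotents V f g d E \<longleftrightarrow>
     (\<exists>W. standard_ordering V f g d W \<and> (\<forall>i\<le>d. primitive_idempotent V f (W i) (E i)))"

definition tridiagonal_system ::
    "'b set \<Rightarrow> nat \<Rightarrow> ('b \<Rightarrow> 'b) \<Rightarrow> (nat \<Rightarrow> 'b \<Rightarrow> 'b) \<Rightarrow> ('b \<Rightarrow> 'b) \<Rightarrow> (nat \<Rightarrow> 'b \<Rightarrow> 'b) \<Rightarrow> bool"
  where
  "tridiagonal_system V d A E As Es \<longleftrightarrow>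
     tridiagonal_pair V A As \<and>
     standard_idempotents V A As d E \<and> standard_idempotents V As A d Es"

definition sharp :: "'b set \<Rightarrow> (nat \<Rightarrow> 'b \<Rightarrow> 'b) \<Rightarrow> bool" where
  "sharp V E \<longleftrightarrow> dim (E 0 ` V) = 1"

definition eigenvalue_sequence ::
    "'b set \<Rightarrow> nat \<Rightarrow> ('b \<Rightarrow> 'b) \<Rightarrow> (nat \<Rightarrow> 'b \<Rightarrow> 'b) \<Rightarrow> (nat \<Rightarrow> 'a) \<Rightarrow> bool" where
  "eigenvalue_sequence V d A E \<theta> \<longleftrightarrow> (\<forall>i\<le>d. \<forall>v\<in>E i ` V. A v = scale (\<theta> i) v)"

definition poly_op :: "'a poly \<Rightarrow> ('b \<Rightarrow> 'b) \<Rightarrow> 'b \<Rightarrow> 'b" where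
  "poly_op p f v = (\<Sum>i\<le>degree p. scale (coeff p i) ((f ^^ i) v))"

definition split_sequence ::
    "'b set \<Rightarrow> nat \<Rightarrow> ('b \<Rightarrow> 'b) \<Rightarrow> (nat \<Rightarrow> 'b \<Rightarrow> 'b) \<Rightarrow>
     (nat \<Rightarrow> 'a) \<Rightarrow> (nat \<Rightarrow> 'a) \<Rightarrow> (nat \<Rightarrow> 'a) \<Rightarrow> bool" where
  "split_sequence V d A Es \<theta> \<theta>s \<zeta> \<longleftrightarrow>
     (\<forall>i\<le>d. \<forall>v\<in>V. Es 0 (poly_op (tau \<theta> i) A (Es 0 v)) =
        scale (\<zeta> i / (\<Prod>h=1..i. \<theta>s 0 - \<theta>s h)) (Es 0 v))"

definition parameter_array ::
    "'b set \<Rightarrow> nat \<Rightarrow> ('b \<Rightarrow> 'b) \<Rightarrow> (nat \<Rightarrow> 'b \<Rightarrow> 'b) \<Rightarrow> ('b \<Rightarrow> 'b) \<Rightarrow> (nat \<Rightarrow> 'b \<Rightarrow> 'b) \<Rightarrow>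
     (nat \<Rightarrow> 'a) \<Rightarrow> (nat \<Rightarrow> 'a) \<Rightarrow> (nat \<Rightarrow> 'a) \<Rightarrow> bool" where
  "parameter_array V d A E As Es \<theta> \<theta>s \<zeta> \<longleftrightarrow>
     eigenvalue_sequence V d A E \<theta> \<and> eigenvalue_sequence V d As Es \<theta>s \<and>
     split_sequence V d A Es \<theta> \<theta>s \<zeta>"

end

text \<open>
  Every finite-dimensional vector space over \<open>'k\<close> is isomorphic to a subspace of the space of
  all sequences \<open>nat \<Rightarrow> 'k\<close>, so it is no restriction to look for the underlying space there.
\<close>

definition seq_scale :: "'k::field \<Rightarrow> (nat \<Rightarrow> 'k) \<Rightarrow> (nat \<Rightarrow> 'k)" where
  "seq_scale c v = (\<lambda>i. c * v i)"

interpretation seq: ambient_space seq_scale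
  by standard (auto simp: seq_scale_def fun_eq_iff algebra_simps)

definition exists_sharp_tridiagonal_system ::
    "nat \<Rightarrow> (nat \<Rightarrow> 'k::field) \<Rightarrow> (nat \<Rightarrow> 'k) \<Rightarrow> (nat \<Rightarrow> 'k) \<Rightarrow> bool" where
  "exists_sharp_tridiagonal_system d \<theta> \<theta>s \<zeta> \<longleftrightarrow>
     (\<exists>V A E As Es. seq.tridiagonal_system V d A E As Es \<and> seq.sharp V E \<and>
        seq.parameter_array V d A E As Es \<theta> \<theta>s \<zeta>)"

end

theory Submission
  imports Defs
begin

text \<open>
  Since \<open>e\<^sup>*\<^sub>i p(a) e\<^sup>*\<^sub>j = 0\<close> when \<open>deg p < |i - j|\<close>, and dually, Lagrange interpolation lets one eliminate
  letters from words in the idempotents: if all but at most \<open>|i - j|\<close> of the words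
  \<open>\<cdots>e\<^sup>*\<^sub>i e\<^sub>k e\<^sup>*\<^sub>j\<cdots>\<close> (\<open>k\<close> varying) lie in a subspace, then all of them do. A lexicographic induction reduces every
  word that begins with \<open>e\<^sup>*\<^sub>0\<close> to words whose index intervals are properly nested, and to words with a second
  \<open>e\<^sup>*\<^sub>0\<close> at position 2. A nested word of length more than three cannot end in \<open>e\<^sup>*\<^sub>0\<close>, so \<open>e\<^sup>*\<^sub>0 T e\<^sup>*\<^sub>0\<close> is
  generated by the elements \<open>e\<^sup>*\<^sub>0 e\<^sub>i e\<^sup>*\<^sub>0\<close>. The same elimination shows that
  \<open>e\<^sup>*\<^sub>0 (e\<^sub>i e\<^sup>*\<^sub>l e\<^sub>j - e\<^sub>j e\<^sup>*\<^sub>l e\<^sub>i) e\<^sup>*\<^sub>0 = 0\<close>, and \<open>l = 0\<close> gives commutativity. Hence \<open>\<mu>\<close> is well defined and onto.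

  If \<open>\<mu>(F) = 0\<close>, let \<open>T\<close> act on the space of a sharp tridiagonal system with split sequence \<open>\<zeta>\<close>; on
  \<open>E\<^sup>*\<^sub>0 V \<noteq> 0\<close> the element \<open>\<mu>(F)\<close> acts as the value of \<open>F\<close> at the point with coordinates
  \<open>\<zeta>\<^sub>i / ((\<theta>\<^sup>*\<^sub>0 - \<theta>\<^sup>*\<^sub>1) \<cdots> (\<theta>\<^sup>*\<^sub>0 - \<theta>\<^sup>*\<^sub>i))\<close>. The admissible \<open>\<zeta>\<close> are the complement of two hypersurfaces, so
  \<open>F = 0\<close> because \<open>K\<close> is infinite.
\<close>

section \<open>Elimination of letters\<close>

text \<open>
  A word \<open>e\<^sup>*(z\<^sub>0) e(d - z\<^sub>1) e\<^sup>*(z\<^sub>2) e(d - z\<^sub>3) \<cdots>\<close> is recorded by its letters \<open>z\<^sub>s\<close>; the index is reversed at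
  odd positions, which makes the combinatorics below the same for both parities.
\<close>

definition lex_below :: "nat \<Rightarrow> (nat \<Rightarrow> nat) \<Rightarrow> (nat \<Rightarrow> nat) \<Rightarrow> bool" where
  "lex_below t w z \<longleftrightarrow> (\<exists>s. 1 \<le> s \<and> s \<le> t \<and> w s < z s \<and> (\<forall>r<s. w r = z r))"

lemma lex_below_trans:
  assumes "lex_below t u w" "lex_below t w z"
  shows "lex_below t u z"
proof -
  obtain r where r: "1 \<le> r" "r \<le> t" "u r < w r" "\<forall>q<r. u q = w q"
    using assms(1) by (auto simp: lex_below_def)
  obtain s where s: "1 \<le> s" "s \<le> t" "w s < z s" "\<forall>q<s. w q = z q"
    using assms(2) by (auto simp: lex_below_def)
  consider "r < s" | "r = s" | "s < r" by linarith
  then show ?thesis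
  proof cases
    case 1 then show ?thesis using r s by (auto simp: lex_below_def intro!: exI[of _ r])
  next
    case 2 then show ?thesis using r s by (auto simp: lex_below_def intro!: exI[of _ r])
  next
    case 3 then show ?thesis using r s by (auto simp: lex_below_def intro!: exI[of _ s])
  qed
qed

text \<open>Turns a descent below a modified word into a descent below the original one when the
  modification only touches positions after \<open>s\<close>.\<close>

lemma lex_below_agree:
  assumes "lex_below s u w" "s \<le> t" "\<And>r. r \<le> s \<Longrightarrow> w r = z r"
  shows "lex_below t u z"
proof -
  obtain q where q: "1 \<le> q" "q \<le> s" "u q < w q" "\<forall>r<q. u r = w r"
    using assms(1) by (auto simp: lex_below_def)
  have "u q < z q" using q assms(3)[of q] by simp
  moreover have "u r = z r" if "r < q" for r using q that assms(3)[of r] by simp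
  ultimately show ?thesis
    using q assms(2) le_trans unfolding lex_below_def by blast
qed

text \<open>Reading off positions 1 to \<open>t\<close> embeds the order in the lexicographic order
  on lists of the fixed length \<open>t\<close>, which is well-founded.\<close>

lemma wfp_lex_below: "wfp (lex_below t)"
proof -
  let ?f = "\<lambda>z. map z [1..<Suc t]"
  have "(w, z) \<in> inv_image (lexn less_than t) ?f" if below: "lex_below t w z" for w z
  proof -
    obtain s where s: "1 \<le> s" "s \<le> t" "w s < z s" "\<forall>r<s. w r = z r"
      using below by (auto simp: lex_below_def)
    have split: "[1..<Suc t] = [1..<s] @ s # [Suc s..<Suc t]"
      using s upt_add_eq_append[of 1 s "Suc t - s"] by (simp add: upt_conv_Cons del: upt_Suc)
    have "?f w = map z [1..<s] @ w s # map w [Suc s..<Suc t]"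
      and "?f z = map z [1..<s] @ z s # map z [Suc s..<Suc t]"
      using s unfolding split by simp_all
    moreover have "length (?f w) = t" "length (?f z) = t" by simp_all
    ultimately have "(?f w, ?f z) \<in> lexn less_than t"
      unfolding lexn_conv using s(3) by blast
    then show ?thesis by simp
  qed
  then have "{(w, z). lex_below t w z} \<subseteq> inv_image (lexn less_than t) ?f" by blast
  then show ?thesis
    unfolding wfp_def by (rule wf_subset[OF wf_inv_image[OF wf_lexn[OF wf_less_than]]])
qed

text \<open>
  In the unreversed indices \<open>x\<^sub>s\<close> this says that each of the intervals with endpoints \<open>x\<^sub>s\<close> and \<open>x\<^sub>s\<^sub>+\<^sub>1\<close>
  contains the next one.
\<close>

definition nested :: "nat \<Rightarrow> nat \<Rightarrow> (nat \<Rightarrow> nat) \<Rightarrow> bool" where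
  "nested d n w \<longleftrightarrow> (\<forall>s<n. w s + w (s + 1) \<le> d) \<and> (\<forall>s. s + 2 \<le> n \<longrightarrow> w s < w (s + 2))"

lemma nested_add: "nested d n w \<Longrightarrow> s < n \<Longrightarrow> w s + w (Suc s) \<le> d"
  by (simp add: nested_def)

lemma nested_less: "nested d n w \<Longrightarrow> s + 2 \<le> n \<Longrightarrow> w s < w (s + 2)"
  by (simp add: nested_def)

lemma nested_SucI:
  assumes "nested d n w" "w n + w (Suc n) \<le> d" "1 \<le> n \<Longrightarrow> w (n - 1) < w (Suc n)"
  shows "nested d (Suc n) w"
  unfolding nested_def
proof (intro conjI allI impI)
  fix s assume "s < Suc n"
  then show "w s + w (s + 1) \<le> d"
    using assms(2) nested_add[OF assms(1), of s] by (cases "s = n") auto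
next
  fix s assume s: "s + 2 \<le> Suc n"
  show "w s < w (s + 2)"
  proof (cases "s + 2 = Suc n")
    case True
    then have "n = Suc s" by simp
    then show ?thesis using assms(3) by simp
  next
    case False
    then show ?thesis using s nested_less[OF assms(1), of s] by simp
  qed
qed

text \<open>\<open>Z z\<close> stands for membership of a word, with letters at positions 0 to
  \<open>N\<close>, in a given subspace. \<open>elim\<close> is interpolation at one inner position,
  the distance of its two neighbours bounding the number of unknown letters; reversing indices
  leaves that distance unchanged. \<open>zero\<close> is the case in which the word splits at
  position 2.\<close>

locale letter_elimination =
  fixes d N :: nat and Z :: "(nat \<Rightarrow> nat) \<Rightarrow> bool"
  assumes elim: "\<And>z s K k. (\<And>r. z r \<le> d) \<Longrightarrow> z 0 = 0 \<Longrightarrow> z N = 0 \<Longrightarrow> 1 \<le> s \<Longrightarrow> s < N \<Longrightarrow> K \<subseteq> {..d} \<Longrightarrow>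
      int (card K) \<le> \<bar>int (z (s - 1)) - int (z (s + 1))\<bar> \<Longrightarrow>
      (\<And>k. k \<le> d \<Longrightarrow> k \<notin> K \<Longrightarrow> Z (z(s := k))) \<Longrightarrow> k \<le> d \<Longrightarrow> Z (z(s := k))"
    and zero: "\<And>z. (\<And>r. z r \<le> d) \<Longrightarrow> z 0 = 0 \<Longrightarrow> z N = 0 \<Longrightarrow> z 2 = 0 \<Longrightarrow> Z z"
begin

text \<open>
  If the first letters that violate nestedness violate \<open>z\<^sub>t + z\<^sub>t\<^sub>+\<^sub>1 \<le> d\<close>, then letter \<open>t\<close> can be eliminated: the
  smaller values are lexicographically below, and the values that break nestedness one position
  earlier are covered by the induction on \<open>t\<close>. If they violate \<open>z\<^sub>t\<^sub>-\<^sub>1 < z\<^sub>t\<^sub>+\<^sub>1\<close>, then the letters \<open>j\<close> and \<open>k\<close>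
  at positions \<open>t - 1\<close> and \<open>t\<close> are eliminated together: outside a box everything is known, and the box is
  peeled off by alternately removing its largest \<open>j\<close> and its largest \<open>k\<close>.
\<close>

lemma nested_reduction:
  assumes "t < N" "\<And>r. z r \<le> d" "z 0 = 0" "z N = 0"
    and "\<And>w. (\<And>r. w r \<le> d) \<Longrightarrow> (\<And>r. t < r \<Longrightarrow> w r = z r) \<Longrightarrow> w 0 = 0 \<Longrightarrow>
      w = z \<or> lex_below t w z \<Longrightarrow> nested d (Suc t) w \<Longrightarrow> Z w"
  shows "Z z"
  using assms
proof (induction t arbitrary: z rule: less_induct)
  case (less t)
  note shorter = less.IH
  from less.prems show ?case
  proof (induction z rule: wfp_induct_rule[OF wfp_lex_below[of t]])
    case (1 z)
    note z = 1(3-5) and H = 1(6)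
    have below: "Z w" if w: "\<And>r. w r \<le> d" "\<And>r. t < r \<Longrightarrow> w r = z r" "w 0 = 0" "lex_below t w z" for w
    proof (rule 1(1)[OF w(4) 1(2) w(1,3)])
      show "w N = 0" using w(2)[of N] z \<open>t < N\<close> by simp
    next
      fix u assume u: "\<And>r. u r \<le> d" "\<And>r. t < r \<Longrightarrow> u r = w r" "u 0 = 0"
        "u = w \<or> lex_below t u w" "nested d (Suc t) u"
      show "Z u"
        by (rule H) (use u w lex_below_trans in auto)
    qed
    \<comment> \<open>The outer induction straightens a shorter prefix first. It suffices that every
      nested outcome lies lexicographically below \<open>z\<close>, since \<open>below\<close>
      covers those.\<close>
    have prefix: "Z w"
      if w: "t' < t" "\<And>r. w r \<le> d" "\<And>r. t < r \<Longrightarrow> w r = z r" "w 0 = 0"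
        and nst: "\<And>u. (\<And>r. u r \<le> d) \<Longrightarrow> (\<And>r. t' < r \<Longrightarrow> u r = w r) \<Longrightarrow>
          u = w \<or> lex_below t' u w \<Longrightarrow> nested d (Suc t') u \<Longrightarrow> lex_below t u z" for t' w
    proof (rule shorter[of t' w])
      show "t' < t" "t' < N" "\<And>r. w r \<le> d" "w 0 = 0" using w \<open>t < N\<close> by auto
      show "w N = 0" using w(3)[of N] z \<open>t < N\<close> by simp
      fix u assume u: "\<And>r. u r \<le> d" "\<And>r. t' < r \<Longrightarrow> u r = w r" "u 0 = 0"
        "u = w \<or> lex_below t' u w" "nested d (Suc t') u"
      show "Z u"
        by (rule below) (use u w nst in auto)
    qed
    show "Z z"
    proof (cases "nested d t z")
      case False
      then have t: "0 < t" by (cases t) (auto simp: nested_def)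
      show ?thesis
      proof (rule prefix[of "t - 1" z])
        fix u assume "u = z \<or> lex_below (t - 1) u z" "nested d (Suc (t - 1)) u"
        then show "lex_below t u z" using False t lex_below_agree[of "t - 1" u z t z] by auto
      qed (use t z in auto)
    next
      case nst: True
      show ?thesis
      proof (cases "nested d (Suc t) z")
        case True
        show ?thesis by (rule H) (use True z in auto)
      next
        case False
        \<comment> \<open>For \<open>t = 0\<close> nestedness is automatic because
          \<open>z 0 = 0\<close>.\<close>
        have t: "1 \<le> t"
          using False nested_SucI[OF nst] z by (cases t) auto
        then have zt: "z (t - 1) + z t \<le> d" using nested_add[OF nst, of "t - 1"] by simp
        show ?thesis
        proof (cases "z t + z (t + 1) \<le> d")
          case False
          have outer: "Z (z(t := k))" if k: "k \<le> d" "k \<notin> {z t..d - z (t - 1)}" for k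
          proof (cases "k < z t")
            case True
            show ?thesis
              by (rule below) (use True k z t in \<open>auto simp: lex_below_def intro!: exI[of _ t]\<close>)
          next
            case False
            then have large: "d < z (t - 1) + k" using k by auto
            show ?thesis
            proof (rule prefix[of "t - 1"])
              fix u assume u: "\<And>r. t - 1 < r \<Longrightarrow> u r = (z(t := k)) r"
                "u = z(t := k) \<or> lex_below (t - 1) u (z(t := k))" "nested d (Suc (t - 1)) u"
              have "u (t - 1) + k \<le> d" using u(1)[of t] nested_add[OF u(3), of "t - 1"] t by simp
              then have "u (t - 1) \<noteq> (z(t := k)) (t - 1)" using large t by auto
              then have "u \<noteq> z(t := k)" by auto
              then have "lex_below (t - 1) u (z(t := k))" using u by blast
              then show "lex_below t u z"
                by (rule lex_below_agree) (use t in auto)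
            qed (use t z k in auto)
          qed
          \<comment> \<open>The interval has \<open>d + 1 - z t - z (t - 1)\<close> elements, and
            the violated inequality reads \<open>z (t + 1) \<ge> d + 1 - z t\<close>.\<close>
          have "int (card {z t..d - z (t - 1)}) \<le> \<bar>int (z (t - 1)) - int (z (t + 1))\<bar>"
            using False zt z(1)[of "t + 1"] by auto
          then have "Z (z(t := z t))"
            by (rule elim[of z t "{z t..d - z (t - 1)}", rotated -3]) (use z t \<open>t < N\<close> outer in auto)
          then show ?thesis by simp
        next
          case True
          then have y: "z (t + 1) \<le> z (t - 1)"
            using False nested_SucI[OF nst] by force
          show ?thesis
          proof (cases "t = 1")
            case True
            \<comment> \<open>Here \<open>y\<close> says \<open>z 2 \<le> z 0 = 0\<close>.\<close>
            then show ?thesis using zero z y by (auto simp: numeral_2_eq_2)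
          next
            case False
            then have t2: "2 \<le> t" using t by simp
            define i J where "i = z (t - 2)" and "J = z (t - 1)"
            have idx: "t - 1 = Suc (t - 2)" "t = Suc (t - 1)" using t2 by auto
            have [simp]: "t - Suc 0 \<noteq> t" "t \<noteq> t - Suc 0" "t - 2 \<noteq> t" "t - 2 \<noteq> t - Suc 0"
              "Suc (t - Suc 0) = t" "t - Suc 0 - Suc 0 = t - 2"
              using t2 by auto
            have iJ: "i + J \<le> d" and Jt: "J + z t \<le> d" and it: "i < z t"
              using nested_add[OF nst, of "t - 2"] nested_add[OF nst, of "t - 1"]
                nested_less[OF nst, of "t - 2"] t2 idx
              by (auto simp: i_def J_def)
            let ?w = "\<lambda>j k. z(t - 1 := j, t := k)"
            have swap: "z(t := k, t - 1 := j) = ?w j k" for j k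
              by (rule fun_upd_twist) simp
            have small: "Z (?w j k)" if "j \<le> d" "k \<le> d" "j < J" for j k
              by (rule below)
                (use that z t2 in \<open>auto simp: lex_below_def J_def intro!: exI[of _ "t - 1"]\<close>)
            have large: "Z (?w j k)" if jk: "j \<le> d" "k \<le> d" "d < i + j" for j k
            proof (rule prefix[of "t - 2"])
              fix u assume u: "\<And>r. t - 2 < r \<Longrightarrow> u r = ?w j k r"
                "u = ?w j k \<or> lex_below (t - 2) u (?w j k)" "nested d (Suc (t - 2)) u"
              have "u (t - 1) = j" using u(1)[of "t - 1"] t2 by auto
              then have "u (t - 2) + j \<le> d" using nested_add[OF u(3), of "t - 2"] idx(1) by simp
              then have "u \<noteq> ?w j k" using jk t2 by (auto simp: i_def)
              then have "lex_below (t - 2) u (?w j k)" using u by blast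
              then show "lex_below t u z"
                by (rule lex_below_agree) (use t2 in auto)
            qed (use t2 z jk in auto)
            \<comment> \<open>If a nested \<open>u\<close> agrees with \<open>z\<close> before
              position \<open>t - 1\<close>, then \<open>i < k\<close>, so \<open>d < J + k\<close>,
              and the letter at \<open>t - 1\<close> drops below \<open>J\<close>. Otherwise an
              earlier letter has dropped.\<close>
            have outer: "Z (?w j k)" if jk: "j \<le> d" "k \<le> d" "k \<le> i \<or> d < J + k" for j k
            proof (rule prefix[of "t - 1"])
              fix u assume u: "\<And>r. t - 1 < r \<Longrightarrow> u r = ?w j k r"
                "u = ?w j k \<or> lex_below (t - 1) u (?w j k)" "nested d (Suc (t - 1)) u"
              have ut: "u t = k" using u(1)[of t] t2 by auto
              have un: "u (t - 2) < k" "u (t - 1) + k \<le> d"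
                using nested_add[OF u(3), of "t - 1"] nested_less[OF u(3), of "t - 2"] ut t2 idx
                by auto
              show "lex_below t u z"
              proof (cases "\<forall>r<t - 1. u r = z r")
                case True
                then have "u (t - 2) = i" using t2 by (auto simp: i_def)
                then have "u (t - 1) < z (t - 1)" using un jk by (auto simp: J_def)
                then show ?thesis using True t2
                  by (auto simp: lex_below_def intro!: exI[of _ "t - 1"])
              next
                case False
                then obtain q where q: "q < t - 1" "u q \<noteq> z q" by blast
                have wz: "?w j k r = z r" if "r < t - 1" for r using that by auto
                have "u \<noteq> ?w j k" using q wz by metis
                then obtain s where s: "1 \<le> s" "s \<le> t - 1" "u s < ?w j k s" "\<forall>r<s. u r = ?w j k r"
                  using u(2) unfolding lex_below_def by blast
                have "s \<noteq> t - 1" using s(4) q wz by metis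
                then have "s < t - 1" using s(2) by simp
                then have "u s < z s" "\<forall>r<s. u r = z r" "s \<le> t"
                  using s wz by (simp_all del: fun_upd_apply)
                then show ?thesis
                  using s(1) unfolding lex_below_def by blast
              qed
            qed (use t2 z jk in auto)
            \<comment> \<open>\<open>c\<close> counts the layers peeled off the box. In the row
              \<open>j = d - i - c\<close> there are \<open>j - J\<close> unknown values of
              \<open>k\<close>, which is within reach because \<open>z (t + 1) \<le> J\<close>. In
              the column \<open>k = d - J - c\<close> that row has left \<open>k - i\<close> unknown
              values of \<open>j\<close>, exactly the distance of the neighbours \<open>i\<close>
              and \<open>k\<close>; so the row comes before the column.\<close>
            have all: "Z (?w j k)" if "j \<le> d" "k \<le> d" "d - i + 1 \<le> j + c \<or> d - J + 1 \<le> k + c" for j k c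
              using that
            proof (induction c arbitrary: j k)
              case 0
              then have "d < i + j \<or> d < J + k" using iJ by linarith
              then show ?case using 0 large outer by blast
            next
              case (Suc c)
              have row: "Z (?w j k)" if jk: "j \<le> d" "k \<le> d" "d - i + 1 = j + Suc c" for j k
              proof (cases "j < J")
                case True then show ?thesis using small jk by blast
              next
                case False
                let ?K = "{k. i < k \<and> k + c < d - J + 1}"
                have K: "?K = {i<..<d - J + 1 - c}" by auto
                have "Z ((z(t - 1 := j))(t := k))"
                proof (rule elim[of "z(t - 1 := j)" t ?K k])
                  show "?K \<subseteq> {..d}" by auto
                  show "int (card ?K) \<le> \<bar>int ((z(t - 1 := j)) (t - 1)) - int ((z(t - 1 := j)) (t + 1))\<bar>"
                    unfolding K using jk False y t2 by (auto simp: J_def)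
                  show "Z ((z(t - 1 := j))(t := k'))" if k': "k' \<le> d" "k' \<notin> ?K" for k'
                  proof -
                    have "k' \<le> i \<or> d - J + 1 \<le> k' + c" using k'(2) by auto
                    then show ?thesis using k'(1) outer Suc.IH jk(1) by blast
                  qed
                qed (use z t2 jk \<open>t < N\<close> in auto)
                then show ?thesis .
              qed
              have column: "Z (?w j k)" if jk: "j \<le> d" "k \<le> d" "d - J + 1 = k + Suc c" for j k
              proof (cases "k \<le> i")
                case True then show ?thesis using outer jk by blast
              next
                case False
                let ?K = "{j. J \<le> j \<and> j + c < d - i}"
                have K: "?K = {J..<d - i - c}" by auto
                have "Z ((z(t := k))(t - 1 := j))"
                proof (rule elim[of "z(t := k)" "t - 1" ?K j])
                  show "?K \<subseteq> {..d}" by auto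
                  show "int (card ?K) \<le> \<bar>int ((z(t := k)) (t - 1 - 1)) - int ((z(t := k)) (t - 1 + 1))\<bar>"
                    unfolding K using jk False t2 iJ by (auto simp: i_def numeral_2_eq_2)
                  show "Z ((z(t := k))(t - 1 := j'))" if j': "j' \<le> d" "j' \<notin> ?K" for j'
                  proof -
                    consider "j' < J" | "d - i + 1 \<le> j' + c" | "d - i + 1 = j' + Suc c"
                      using j'(2) by fastforce
                    then have "Z (?w j' k)"
                      by cases (use small Suc.IH row j'(1) jk(2) in blast)+
                    then show ?thesis unfolding swap .
                  qed
                qed (use z t2 jk \<open>t < N\<close> in auto)
                then show ?thesis unfolding swap .
              qed
              consider "d - i + 1 \<le> j + c \<or> d - J + 1 \<le> k + c"
                | "d - i + 1 = j + Suc c" | "d - J + 1 = k + Suc c"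
                using Suc.prems(3) by linarith
              then show ?case
                by cases (use Suc.prems row column Suc.IH in blast)+
            qed
            \<comment> \<open>After \<open>d + 1\<close> layers the box is exhausted.\<close>
            have "J \<le> d" "d - i + 1 \<le> J + (d + 1)" using z(1) by (simp_all add: J_def)
            then have "Z (?w J (z t))" using all z(1) by blast
            then show ?thesis unfolding J_def by (simp only: fun_upd_triv)
          qed
        qed
      qed
    qed
  qed
qed

text \<open>A word nested up to its last position would satisfy \<open>w (N - 2) < w N = 0\<close>.
  So for \<open>t = N - 1\<close> the reduction leaves nothing to verify.\<close>

theorem all_words:
  assumes "2 < N" "\<And>r. z r \<le> d" "z 0 = 0" "z N = 0"
  shows "Z z"
proof (rule nested_reduction[of "N - 1" z])
  fix w assume w: "\<And>r. N - 1 < r \<Longrightarrow> w r = z r" "nested d (Suc (N - 1)) w"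
  then have "w (N - 2) < w (N - 2 + 2)"
    using nested_less[OF w(2), of "N - 2"] assms(1) by simp
  moreover have "N - 2 + 2 = N" using assms(1) by simp
  ultimately have "w (N - 2) < w N" by metis
  then show "Z w" using w(1)[of N] assms(1,4) by simp
qed (use assms in auto)

end

section \<open>Computing modulo a two-sided ideal\<close>

text \<open>Lagrange interpolation: a polynomial of degree \<open>card K - 1\<close> that vanishes
  at \<open>\<phi> j\<close> for all other \<open>j\<close> in \<open>K\<close> turns
  \<open>rel\<close> into a relation whose only unknown term is a nonzero multiple of
  \<open>v k\<close>.\<close>

lemma (in vector_space) interpolation_elim:
  fixes \<phi> :: "nat \<Rightarrow> 'a"
  assumes S: "subspace S" and inj: "inj_on \<phi> {..d}" and K: "K \<subseteq> {..d}" "card K \<le> n"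
    and rel: "\<And>p. degree p < n \<Longrightarrow> (\<Sum>k\<le>d. poly p (\<phi> k) *s v k) \<in> S"
    and outside: "\<And>k. k \<le> d \<Longrightarrow> k \<notin> K \<Longrightarrow> v k \<in> S"
    and k: "k \<le> d"
  shows "v k \<in> S"
proof (cases "k \<in> K")
  case True
  have fin: "finite K" using K finite_subset by blast
  define p where "p = (\<Prod>j\<in>K - {k}. [:- \<phi> j, 1:])"
  have root: "poly p (\<phi> j) = 0" if "j \<in> K - {k}" for j
    using that fin by (auto simp: p_def poly_prod)
  have nz: "poly p (\<phi> k) \<noteq> 0"
    using fin K inj k by (auto simp: p_def poly_prod inj_on_def)
  have "degree p \<le> (\<Sum>j\<in>K - {k}. degree [:- \<phi> j, 1:])"
    using degree_prod_sum_le[of "K - {k}" "\<lambda>j. [:- \<phi> j, 1:]"] fin by (simp add: p_def o_def)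
  also have "\<dots> = card K - 1" using True by simp
  also have "\<dots> < n" using K(2) True fin card_gt_0_iff[of K] by fastforce
  finally have "(\<Sum>j\<le>d. poly p (\<phi> j) *s v j) \<in> S" by (rule rel)
  moreover have "(\<Sum>j\<in>{..d} - {k}. poly p (\<phi> j) *s v j) \<in> S"
  proof (rule subspace_sum[OF S])
    fix j assume "j \<in> {..d} - {k}"
    then show "poly p (\<phi> j) *s v j \<in> S"
      using root[of j] outside[of j] S by (cases "j \<in> K") (auto simp: subspace_0 subspace_scale)
  qed
  ultimately have "poly p (\<phi> k) *s v k \<in> S"
    using k S by (simp add: sum.remove[of _ k] subspace_diff[OF S]) (metis add_diff_cancel_right' subspace_diff)
  then have "inverse (poly p (\<phi> k)) *s (poly p (\<phi> k) *s v k) \<in> S"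
    by (rule subspace_scale[OF S])
  then show ?thesis using nz by simp
qed (use outside k in auto)

text \<open>The relations are used as congruences in a type-class ring, so that words can be
  rearranged without carrier conditions; the quotient itself enters only later.\<close>

locale two_sided_ideal =
  fixes J :: "'r::ring_1 set"
  assumes zero: "0 \<in> J"
    and diff: "x \<in> J \<Longrightarrow> y \<in> J \<Longrightarrow> x - y \<in> J"
    and mult_left: "x \<in> J \<Longrightarrow> r * x \<in> J"
    and mult_right: "x \<in> J \<Longrightarrow> x * r \<in> J"
begin

definition cong :: "'r \<Rightarrow> 'r \<Rightarrow> bool" (infix \<open>\<approx>\<close> 50) where
  "x \<approx> y \<longleftrightarrow> x - y \<in> J"

lemma cong_refl [simp, intro]: "x \<approx> x"
  by (simp add: cong_def zero)

lemma cong_sym: "x \<approx> y \<Longrightarrow> y \<approx> x"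
  using diff[OF zero, of "x - y"] by (simp add: cong_def)

lemma plus: "x \<in> J \<Longrightarrow> y \<in> J \<Longrightarrow> x + y \<in> J"
  using diff[of x "0 - y"] diff[OF zero, of y] by simp

lemma cong_trans [trans]: "x \<approx> y \<Longrightarrow> y \<approx> z \<Longrightarrow> x \<approx> z"
  using plus[of "x - y" "y - z"] by (simp add: cong_def)

lemma cong_add: "x \<approx> y \<Longrightarrow> x' \<approx> y' \<Longrightarrow> x + x' \<approx> y + y'"
  using plus[of "x - y" "x' - y'"] by (simp add: cong_def algebra_simps)

lemma cong_mult: "x \<approx> y \<Longrightarrow> x' \<approx> y' \<Longrightarrow> x * x' \<approx> y * y'"
  using plus[OF mult_right[of "x - y" x'] mult_left[of "x' - y'" y]]
  by (simp add: cong_def algebra_simps)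

lemma cong_sum: "(\<And>i. i \<in> A \<Longrightarrow> f i \<approx> g i) \<Longrightarrow> sum f A \<approx> sum g A"
  by (induction A rule: infinite_finite_induct) (auto intro: cong_add)

lemma cong_0_iff: "x \<approx> 0 \<longleftrightarrow> x \<in> J"
  by (simp add: cong_def)

end

locale scalar_ideal = two_sided_ideal J for J :: "'r::ring_1 set" +
  fixes sc :: "'k::field \<Rightarrow> 'r"
  assumes sc_1 [simp]: "sc 1 = 1"
    and sc_add: "sc (b + c) = sc b + sc c"
    and sc_mult: "sc (b * c) = sc b * sc c"
    and sc_central: "sc c * x = x * sc c"
begin

sublocale vs: vector_space "\<lambda>c x. sc c * x"
  by standard (simp_all add: sc_add sc_mult algebra_simps)

lemma sc_0 [simp]: "sc 0 = 0"
  using sc_add[of 0 0] by simp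

lemma sc_left_commute: "x * (sc c * y) = sc c * (x * y)"
  by (metis sc_central mult.assoc)

lemma subspace_J: "vs.subspace J"
  unfolding vs.subspace_def using zero plus mult_left by blast

definition ev :: "'k poly \<Rightarrow> 'r \<Rightarrow> 'r" where
  "ev p x = (\<Sum>i\<le>degree p. sc (coeff p i) * x ^ i)"

lemma ev_upto: "degree p \<le> n \<Longrightarrow> ev p x = (\<Sum>i\<le>n. sc (coeff p i) * x ^ i)"
  unfolding ev_def by (rule sum.mono_neutral_left) (auto simp: coeff_eq_0)

lemma ev_add: "ev (p + q) x = ev p x + ev q x"
proof -
  define n where "n = max (degree p) (degree q)"
  have "degree p \<le> n" "degree q \<le> n" "degree (p + q) \<le> n"
    by (auto simp: n_def intro: degree_add_le)
  then show ?thesis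
    by (simp add: ev_upto[of _ n] sc_add distrib_right sum.distrib)
qed

lemma ev_smult: "ev (Polynomial.smult c p) x = sc c * ev p x"
proof -
  have "ev (Polynomial.smult c p) x = (\<Sum>i\<le>degree p. sc (coeff (Polynomial.smult c p) i) * x ^ i)"
    by (rule ev_upto) (rule degree_smult_le)
  then show ?thesis by (simp add: ev_def[of p] sum_distrib_left)
qed

end

text \<open>One half of the defining relations: \<open>a\<close> with its spectral idempotents
  \<open>e\<close>, acting tridiagonally on the family \<open>f\<close>. Two copies with the
  families exchanged make up the whole presentation.\<close>

locale tridiagonal_action = scalar_ideal J sc for J :: "'r::ring_1 set" and sc :: "'k::field \<Rightarrow> 'r" +
  fixes d :: nat and \<theta> :: "nat \<Rightarrow> 'k" and a :: 'r and e f :: "nat \<Rightarrow> 'r"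
  assumes distinct: "inj_on \<theta> {..d}"
    and orth: "i \<le> d \<Longrightarrow> j \<le> d \<Longrightarrow> e i * e j \<approx> (if i = j then e i else 0)"
    and sum_one: "1 \<approx> (\<Sum>i\<le>d. e i)"
    and spectral: "a \<approx> (\<Sum>i\<le>d. sc (\<theta> i) * e i)"
    and triple: "i \<le> d \<Longrightarrow> j \<le> d \<Longrightarrow> k \<le> d \<Longrightarrow> int k < \<bar>int i - int j\<bar> \<Longrightarrow> f i * a ^ k * f j \<approx> 0"
begin

lemma power_spectral: "a ^ k \<approx> (\<Sum>i\<le>d. sc (\<theta> i ^ k) * e i)"
proof (induction k)
  case 0
  then show ?case using sum_one by simp
next
  case (Suc k)
  have "a ^ Suc k \<approx> (\<Sum>i\<le>d. sc (\<theta> i) * e i) * (\<Sum>j\<le>d. sc (\<theta> j ^ k) * e j)"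
    using cong_mult[OF spectral Suc] by simp
  also have "\<dots> = (\<Sum>i\<le>d. \<Sum>j\<le>d. sc (\<theta> i) * (sc (\<theta> j ^ k) * (e i * e j)))"
    by (simp add: sum_product mult.assoc sc_left_commute[of "e _"])
  also have "\<dots> \<approx> (\<Sum>i\<le>d. \<Sum>j\<le>d. sc (\<theta> i) * (sc (\<theta> j ^ k) * (if i = j then e i else 0)))"
    by (intro cong_sum cong_mult cong_refl orth) auto
  also have "\<dots> = (\<Sum>i\<le>d. sc (\<theta> i ^ Suc k) * e i)"
    by (intro sum.cong refl) (simp add: if_distrib[of "(*) _"] sum.delta cong: if_cong)
  finally show ?case .
qed

lemma ev_spectral: "ev p a \<approx> (\<Sum>i\<le>d. sc (poly p (\<theta> i)) * e i)"
proof -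
  have "ev p a \<approx> (\<Sum>r\<le>degree p. sc (coeff p r) * (\<Sum>i\<le>d. sc (\<theta> i ^ r) * e i))"
    unfolding ev_def by (intro cong_sum cong_mult cong_refl power_spectral)
  also have "\<dots> = (\<Sum>i\<le>d. \<Sum>r\<le>degree p. sc (coeff p r * \<theta> i ^ r) * e i)"
    by (subst sum.swap) (simp add: sum_distrib_left)
  also have "\<dots> = (\<Sum>i\<le>d. sc (poly p (\<theta> i)) * e i)"
  proof -
    have "sc (\<Sum>r\<in>A. h r) = (\<Sum>r\<in>A. sc (h r))" for h and A :: "nat set"
      by (induction A rule: infinite_finite_induct) (auto simp: sc_add)
    then show ?thesis by (simp add: poly_altdef sum_distrib_right)
  qed
  finally show ?thesis .
qed

text \<open>Expanded in powers of \<open>a\<close>, \<open>f i * ev p a * f j\<close> is a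
  combination of terms killed by \<open>triple\<close>; expanded in the idempotents
  \<open>e k\<close>, it is this sum.\<close>

lemma triple_poly:
  assumes "i \<le> d" "j \<le> d" "int (degree p) < \<bar>int i - int j\<bar>"
  shows "(\<Sum>k\<le>d. sc (poly p (\<theta> k)) * (f i * e k * f j)) \<in> J"
proof -
  have "(\<Sum>k\<le>d. sc (poly p (\<theta> k)) * (f i * e k * f j)) = f i * (\<Sum>k\<le>d. sc (poly p (\<theta> k)) * e k) * f j"
    by (simp add: sum_distrib_left sum_distrib_right mult.assoc sc_left_commute[of "f _"])
  also have "\<dots> \<approx> f i * ev p a * f j"
    by (intro cong_mult cong_refl cong_sym[OF ev_spectral])
  also have "\<dots> = (\<Sum>r\<le>degree p. sc (coeff p r) * (f i * a ^ r * f j))"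
    by (simp add: ev_def sum_distrib_left sum_distrib_right mult.assoc sc_left_commute[of "f _"])
  also have "\<dots> \<approx> (\<Sum>r\<le>degree p. sc (coeff p r) * 0)"
    by (intro cong_sum cong_mult cong_refl triple) (use assms in auto)
  finally show ?thesis by (simp add: cong_0_iff)
qed

end

section \<open>Alternating words in the two families of idempotents\<close>

locale tridiagonal_relations =
  A: tridiagonal_action J sc d \<theta> a e es + As: tridiagonal_action J sc d \<theta>s as es e
  for J :: "'r::ring_1 set" and sc :: "'k::field \<Rightarrow> 'r" and d and \<theta> \<theta>s :: "nat \<Rightarrow> 'k" and a as e es
begin

notation A.cong (infix \<open>\<approx>\<close> 50)

definition letter :: "nat \<Rightarrow> nat \<Rightarrow> 'r" where
  "letter s x = (if even s then es x else e (d - x))"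

lemma letter_simps [simp]: "even s \<Longrightarrow> letter s x = es x" "odd s \<Longrightarrow> letter s x = e (d - x)"
  by (simp_all add: letter_def)

text \<open>The upper bound is exclusive: a word whose last letter is at position \<open>N\<close>
  is \<open>word z 0 (Suc N)\<close>.\<close>

definition word :: "(nat \<Rightarrow> nat) \<Rightarrow> nat \<Rightarrow> nat \<Rightarrow> 'r" where
  "word z i j = prod_list (map (\<lambda>s. letter s (z s)) [i..<j])"

lemma word_append: "i \<le> j \<Longrightarrow> j \<le> k \<Longrightarrow> word z i k = word z i j * word z j k"
  using upt_add_eq_append[of i j "k - j"] by (simp add: word_def)

lemma word_single: "word z i (Suc i) = letter i (z i)"
  by (simp add: word_def)

lemma word_empty: "word z i i = 1"
  by (simp add: word_def)

lemma word_shift: "word (\<lambda>s. z (s + 2)) i j = word z (i + 2) (j + 2)"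
proof -
  have "[i + 2..<j + 2] = map (\<lambda>s. s + 2) [i..<j]" by (induction j) auto
  then show ?thesis by (simp add: word_def o_def letter_def)
qed

lemma word_cong: "(\<And>s. i \<le> s \<Longrightarrow> s < j \<Longrightarrow> z s = w s) \<Longrightarrow> word z i j = word w i j"
  unfolding word_def by (intro arg_cong[where f = prod_list] map_cong) auto

lemma word_split:
  assumes "r + 2 \<le> N"
  shows "word z 0 (Suc N) = word z 0 r *
    (letter r (z r) * letter (Suc r) (z (Suc r)) * letter (r + 2) (z (r + 2))) * word z (r + 3) (Suc N)"
proof -
  have "word z 0 (Suc N) = word z 0 r * word z r (Suc N)"
    using assms by (intro word_append) auto
  also have "word z r (Suc N) = word z r (Suc r) * word z (Suc r) (Suc N)"
    using assms by (intro word_append) auto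
  also have "word z (Suc r) (Suc N) = word z (Suc r) (Suc (Suc r)) * word z (Suc (Suc r)) (Suc N)"
    using assms by (intro word_append) auto
  also have "word z (Suc (Suc r)) (Suc N) =
      word z (Suc (Suc r)) (Suc (Suc (Suc r))) * word z (Suc (Suc (Suc r))) (Suc N)"
    using assms by (intro word_append) auto
  finally show ?thesis
    unfolding word_single by (simp only: mult.assoc numeral_2_eq_2 numeral_3_eq_3 add_Suc_right add_0_right)
qed

text \<open>The varying letter stands between two fixed letters of the other family, so
  \<open>triple_poly\<close> applies. For even \<open>s\<close> it is \<open>e (d - k)\<close>,
  whence the reversed nodes.\<close>

lemma word_relation:
  assumes s: "Suc s < N" and z: "\<And>r. z r \<le> d"
    and p: "int (degree p) < \<bar>int (z s) - int (z (s + 2))\<bar>"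
  shows "(\<Sum>k\<le>d. sc (poly p (if odd s then \<theta>s k else \<theta> (d - k))) * word (z(Suc s := k)) 0 (Suc N)) \<in> J"
proof -
  let ?L = "word z 0 s" and ?R = "word z (s + 3) (Suc N)"
  let ?m = "\<lambda>k. letter s (z s) * letter (Suc s) k * letter (s + 2) (z (s + 2))"
  have sp: "word (z(Suc s := k)) 0 (Suc N) = ?L * ?m k * ?R" for k
  proof -
    have "word (z(Suc s := k)) 0 s = ?L" "word (z(Suc s := k)) (s + 3) (Suc N) = ?R"
      by (auto intro: word_cong)
    then show ?thesis using s word_split[of s N "z(Suc s := k)"] by simp
  qed
  have "(\<Sum>k\<le>d. sc (poly p (if odd s then \<theta>s k else \<theta> (d - k))) * ?m k) \<in> J"
  proof (cases "odd s")
    case True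
    then show ?thesis
      using As.triple_poly[of "d - z s" "d - z (s + 2)" p] p z[of s] z[of "s + 2"]
      by (simp add: of_nat_diff algebra_simps)
  next
    case False
    have "(\<Sum>k\<le>d. sc (poly p (\<theta> (d - k))) * (es (z s) * e (d - k) * es (z (s + 2)))) =
      (\<Sum>k\<le>d. sc (poly p (\<theta> k)) * (es (z s) * e k * es (z (s + 2))))"
      by (rule sum.reindex_bij_witness[where i = "\<lambda>k. d - k" and j = "\<lambda>k. d - k"]) auto
    then show ?thesis
      using A.triple_poly[of "z s" "z (s + 2)" p] p z False by simp
  qed
  then have "?L * (\<Sum>k\<le>d. sc (poly p (if odd s then \<theta>s k else \<theta> (d - k))) * ?m k) * ?R \<in> J"
    by (intro A.mult_left A.mult_right)
  then show ?thesis
    unfolding sp by (simp add: sum_distrib_left sum_distrib_right mult.assoc A.sc_left_commute[of ?L])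
qed

lemma inj_letter_scalar: "inj_on (\<lambda>k. if b then \<theta>s k else \<theta> (d - k)) {..d}"
proof (cases b)
  case False
  have "inj_on (\<theta> \<circ> (\<lambda>k. d - k)) {..d}"
    by (rule comp_inj_on) (auto simp: inj_on_def dest: inj_onD[OF A.distinct])
  then show ?thesis using False by (simp add: o_def)
qed (simp add: As.distinct)

text \<open>Containing \<open>J\<close> makes \<open>S\<close> the preimage of a multiplicatively
  closed subspace of the quotient. The instance that matters is \<open>Phi_range\<close>.\<close>

definition corner_closed :: "'r set \<Rightarrow> bool" where
  "corner_closed S \<longleftrightarrow> A.vs.subspace S \<and> J \<subseteq> S \<and> (\<forall>x\<in>S. \<forall>y\<in>S. x * y \<in> S) \<and>
     (\<forall>i\<le>d. es 0 * e i * es 0 \<in> S)"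

lemma corner_closedD:
  assumes "corner_closed S"
  shows "A.vs.subspace S" "J \<subseteq> S" "x \<in> S \<Longrightarrow> y \<in> S \<Longrightarrow> x * y \<in> S"
    "i \<le> d \<Longrightarrow> es 0 * e i * es 0 \<in> S"
  using assms by (auto simp: corner_closed_def)

lemma closed_cong:
  assumes "A.vs.subspace S" "J \<subseteq> S" "x \<approx> y" "y \<in> S"
  shows "x \<in> S"
  using A.vs.subspace_add[of S "x - y" y] assms by (auto simp: A.cong_def)

lemma es0_idem: "es 0 \<approx> es 0 * es 0"
  using A.cong_sym[OF As.orth[of 0 0]] by simp

text \<open>\<open>elim\<close> is interpolation applied to \<open>word_relation\<close>. For
  \<open>zero\<close>, doubling the idempotent \<open>es 0\<close> at position 2 splits off
  \<open>es 0 * e (d - z 1) * es 0\<close> and leaves a word shorter by two, covered by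
  \<open>IH\<close>.\<close>

lemma word_letter_elimination: "letter_elimination d N (\<lambda>z. word z 0 (Suc N) \<in> S)"
  if S: "corner_closed S" and IH: "\<And>z. (\<And>r. z r \<le> d) \<Longrightarrow> z 0 = 0 \<Longrightarrow> z (N - 2) = 0 \<Longrightarrow> word z 0 (Suc (N - 2)) \<in> S"
    and N: "2 < N" for S N
proof
  fix z s K k
  assume z: "\<And>r. z r \<le> d" and s: "1 \<le> s" "s < N" and K: "K \<subseteq> {..d}"
    "int (card K) \<le> \<bar>int (z (s - 1)) - int (z (s + 1))\<bar>"
    "\<And>k. k \<le> d \<Longrightarrow> k \<notin> K \<Longrightarrow> word (z(s := k)) 0 (Suc N) \<in> S" and k: "k \<le> d"
  obtain r where r: "s = Suc r" using s by (cases s) auto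
  show "word (z(s := k)) 0 (Suc N) \<in> S"
  proof (rule A.vs.interpolation_elim[OF _ inj_letter_scalar[of "odd r"],
      where v = "\<lambda>k. word (z(s := k)) 0 (Suc N)" and K = K
        and n = "nat \<bar>int (z (s - 1)) - int (z (s + 1))\<bar>"])
    show "A.vs.subspace S" using S by (rule corner_closedD)
    show "(\<Sum>k\<le>d. sc (poly p (if odd r then \<theta>s k else \<theta> (d - k))) * word (z(s := k)) 0 (Suc N)) \<in> S"
      if "degree p < nat \<bar>int (z (s - 1)) - int (z (s + 1))\<bar>" for p
    proof -
      have "int (degree p) < \<bar>int (z r) - int (z (r + 2))\<bar>" using that r by simp
      then show ?thesis
        using word_relation[of r N z p] s(2) z corner_closedD(2)[OF S] unfolding r by blast
    qed
  qed (use K k in auto)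
next
  fix z
  assume z: "\<And>r. z r \<le> d" "z 0 = 0" "z N = 0" "z 2 = 0"
  let ?w = "\<lambda>r. z (r + 2)"
  have "word z 0 (Suc N) = word z 0 2 * (word z 2 3 * word z 3 (Suc N))"
    using N by (simp add: word_append[of 0 2 "Suc N"] word_append[of 2 3 "Suc N"])
  also have "word z 2 3 = es 0" using word_single[of z 2] z by (simp add: numeral_3_eq_3 numeral_2_eq_2)
  also have "word z 0 2 * (es 0 * word z 3 (Suc N)) \<approx> word z 0 2 * (es 0 * es 0 * word z 3 (Suc N))"
    by (intro A.cong_mult A.cong_refl es0_idem)
  also have "\<dots> = (word z 0 2 * es 0) * (es 0 * word z 3 (Suc N))"
    by (simp add: mult.assoc)
  also have "word z 0 2 * es 0 = es 0 * e (d - z 1) * es 0"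
    using z word_append[of 0 1 2 z] word_single[of z 0] word_single[of z 1]
    by (simp add: numeral_2_eq_2)
  \<comment> \<open>A shift by two keeps the parity of each position, hence the family of each
    letter.\<close>
  also have "es 0 * word z 3 (Suc N) = word ?w 0 (Suc (N - 2))"
  proof -
    have "word ?w 1 (Suc (N - 2)) = word z 3 (Suc N)"
    proof -
      have "Suc (N - 2) + 2 = Suc N" "1 + 2 = (3::nat)" using N by simp_all
      then show ?thesis using word_shift[of z 1 "Suc (N - 2)"] by (simp only:)
    qed
    moreover have "word ?w 0 1 = es 0" using word_single[of ?w 0] z by (simp add: numeral_2_eq_2)
    ultimately show ?thesis using word_append[of 0 1 "Suc (N - 2)" ?w] by simp
  qed
  finally have "word z 0 (Suc N) \<approx> (es 0 * e (d - z 1) * es 0) * word ?w 0 (Suc (N - 2))" .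
  moreover have "word ?w 0 (Suc (N - 2)) \<in> S"
  proof (rule IH)
    have "N - 2 + 2 = N" using N by simp
    then show "z (N - 2 + 2) = 0" using z by (simp only:)
  qed (use z in \<open>simp_all flip: numeral_2_eq_2\<close>)
  ultimately show "word z 0 (Suc N) \<in> S"
    using closed_cong[OF corner_closedD(1,2)[OF S]] corner_closedD(3,4)[OF S] by simp
qed

text \<open>Induction on the length. For \<open>N = 0\<close> the sum of the \<open>e i\<close> is
  inserted between two copies of \<open>es 0\<close>, for \<open>N = 2\<close> the word is one of
  the given elements, and longer words follow from \<open>all_words\<close>.\<close>

lemma corner_word:
  assumes S: "corner_closed S" and "even N" "\<And>r. z r \<le> d" "z 0 = 0" "z N = 0"
  shows "word z 0 (Suc N) \<in> S"
  using assms(2-)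
proof (induction N arbitrary: z rule: less_induct)
  case (less N)
  consider "N = 0" | "N = 2" | "2 < N" using less.prems by (cases "N = 1") (auto, linarith)
  then show ?case
  proof cases
    case 1
    have "es 0 \<approx> es 0 * 1 * es 0" using es0_idem by simp
    also have "\<dots> \<approx> es 0 * (\<Sum>i\<le>d. e i) * es 0"
      by (intro A.cong_mult A.cong_refl A.sum_one)
    also have "\<dots> = (\<Sum>i\<le>d. es 0 * e i * es 0)"
      by (simp add: sum_distrib_left sum_distrib_right)
    finally have "es 0 \<approx> (\<Sum>i\<le>d. es 0 * e i * es 0)" .
    moreover have "(\<Sum>i\<le>d. es 0 * e i * es 0) \<in> S"
      by (rule A.vs.subspace_sum[OF corner_closedD(1)[OF S]]) (simp add: corner_closedD(4)[OF S])
    ultimately have "es 0 \<in> S" by (rule closed_cong[OF corner_closedD(1,2)[OF S]])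
    then show ?thesis using 1 less.prems by (simp add: word_single)
  next
    case 2
    have "word z 0 (Suc N) = es 0 * e (d - z 1) * es 0"
      using word_split[of 0 2 z] 2 less.prems(3,4)
      by (simp add: word_empty flip: numeral_2_eq_2)
    then show ?thesis using corner_closedD(4)[OF S] by simp
  next
    case 3
    interpret letter_elimination d N "\<lambda>z. word z 0 (Suc N) \<in> S"
      by (rule word_letter_elimination[OF S less.IH 3]) (use 3 less.prems in auto)
    show ?thesis by (rule all_words) (use 3 less.prems in auto)
  qed
qed

text \<open>The span \<open>Y\<close> of \<open>J\<close> and the alternating words beginning with
  \<open>es 0\<close> is stable under right multiplication by each generator: a letter of the last
  letter's family is absorbed or gives zero, one of the other family extends the word. A final
  factor \<open>es 0\<close> leads to \<open>corner_word\<close>.\<close>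

lemma corner_generated:
  assumes S: "corner_closed S" and gs: "set gs \<subseteq> {a, as} \<union> e ` {..d} \<union> es ` {..d}"
  shows "es 0 * prod_list gs * es 0 \<in> S"
proof -
  have subS: "A.vs.subspace S" "J \<subseteq> S" using corner_closedD[OF S] by auto
  define W where "W = {word z 0 (Suc n) |z n. z 0 = 0 \<and> (\<forall>r. z r \<le> d)}"
  define Y where "Y = A.vs.span (W \<union> J)"
  have subY: "A.vs.subspace Y" "J \<subseteq> Y" "W \<subseteq> Y"
    using A.vs.span_superset[of "W \<union> J"] by (auto simp: Y_def A.vs.subspace_span)
  \<comment> \<open>General in \<open>X\<close> and \<open>y\<close> because it serves twice: with
    \<open>X = Y\<close> for one more generator, and with \<open>X = S\<close> for the closing
    \<open>es 0\<close>.\<close>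
  have Y_mult: "x * y \<in> X"
    if x: "x \<in> Y" and X: "A.vs.subspace X" "J \<subseteq> X" and word: "\<And>w. w \<in> W \<Longrightarrow> w * y \<in> X" for x y X
    using x unfolding Y_def
  proof (induction rule: A.vs.span_induct_alt)
    case base
    then show ?case using X by (simp add: A.vs.subspace_0)
  next
    case (step c b v)
    have "b * y \<in> X" using step X word A.mult_right by auto
    then have "sc c * (b * y) + v * y \<in> X" using X step by (intro A.vs.subspace_add A.vs.subspace_scale)
    then show ?case by (simp add: algebra_simps)
  qed
  have collapse: "word z 0 (Suc n) * letter n x \<approx> (if x = z n then word z 0 (Suc n) else 0)"
    if "\<And>r. z r \<le> d" "x \<le> d" for z n x
  proof -
    have "d - z n = d - x \<longleftrightarrow> x = z n" using that(2) that(1)[of n] by linarith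
    then have "letter n (z n) * letter n x \<approx> (if x = z n then letter n (z n) else 0)"
      using that(2) that(1)[of n] A.orth[of "d - z n" "d - x"] As.orth[of "z n" x]
      by (cases "even n") auto
    then have "word z 0 n * (letter n (z n) * letter n x) \<approx> word z 0 n * (if x = z n then letter n (z n) else 0)"
      by (intro A.cong_mult A.cong_refl)
    then show ?thesis using word_append[of 0 n "Suc n" z] word_single[of z n] by (auto simp: mult.assoc)
  qed
  have extend: "word z 0 (Suc n) * letter (Suc n) x = word (z(Suc n := x)) 0 (Suc (Suc n))" for z n x
    using word_append[of 0 "Suc n" "Suc (Suc n)" "z(Suc n := x)"] word_single[of "z(Suc n := x)" "Suc n"]
      word_cong[of 0 "Suc n" "z(Suc n := x)" z] by simp
  have W_letter: "w * letter s x \<in> Y" if w: "w \<in> W" and x: "x \<le> d" for w s x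
  proof -
    obtain z n where z: "w = word z 0 (Suc n)" "z 0 = 0" "\<And>r. z r \<le> d"
      using w by (auto simp: W_def)
    show ?thesis
    proof (cases "even s = even n")
      case True
      then have "w * letter s x \<approx> (if x = z n then word z 0 (Suc n) else 0)"
        using collapse[where z = z and n = n, OF z(3) x] z by (simp add: letter_def)
      moreover have "(if x = z n then word z 0 (Suc n) else 0) \<in> Y"
        using subY z by (auto simp: W_def A.vs.subspace_0)
      ultimately show ?thesis using closed_cong[OF subY(1,2)] by blast
    next
      case False
      then have "w * letter s x = word (z(Suc n := x)) 0 (Suc (Suc n))"
        using extend[where z = z and n = n and x = x] z by (simp add: letter_def)
      moreover have "\<dots> \<in> W"
        unfolding W_def using z x by (auto intro!: exI[of _ "z(Suc n := x)"] exI[of _ "Suc n"])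
      ultimately show ?thesis using subY by auto
    qed
  qed
  \<comment> \<open>\<open>d - i\<close> undoes the index reversal; the position 1 only selects the
    family \<open>e\<close>.\<close>
  have Y_e: "x * e i \<in> Y" if "x \<in> Y" "i \<le> d" for x i
    using Y_mult[OF that(1) subY(1,2)] W_letter[of _ "d - i" 1] that by auto
  have Y_es: "x * es i \<in> Y" if "x \<in> Y" "i \<le> d" for x i
    using Y_mult[OF that(1) subY(1,2)] W_letter[of _ i 0] that by auto
  have "x * g \<in> Y" if x: "x \<in> Y" and g: "g \<in> set gs" for x g
  proof -
    have sum: "x * g \<in> Y" if "g \<approx> (\<Sum>i\<le>d. sc (\<phi> i) * h i)" "\<And>i. i \<le> d \<Longrightarrow> x * h i \<in> Y" for \<phi> h
    proof (rule closed_cong[OF subY(1,2)])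
      show "x * g \<approx> x * (\<Sum>i\<le>d. sc (\<phi> i) * h i)" using that by (intro A.cong_mult A.cong_refl)
      show "x * (\<Sum>i\<le>d. sc (\<phi> i) * h i) \<in> Y"
        using that subY by (auto simp: sum_distrib_left A.sc_left_commute[of x] intro!: A.vs.subspace_sum A.vs.subspace_scale)
    qed
    have "g = a \<or> g = as \<or> (\<exists>i\<le>d. g = e i) \<or> (\<exists>i\<le>d. g = es i)" using g gs by auto
    then show ?thesis
      using sum[of \<theta> e] sum[of \<theta>s es] A.spectral As.spectral Y_e[OF x] Y_es[OF x] by auto
  qed
  then have "x * prod_list hs \<in> Y" if "x \<in> Y" "set hs \<subseteq> set gs" for x hs
    using that by (induction hs arbitrary: x) (auto simp flip: mult.assoc)
  moreover have "es 0 \<in> Y"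
  proof -
    have "es 0 = word (\<lambda>_. 0) 0 (Suc 0)" by (simp add: word_single)
    then have "es 0 \<in> W" unfolding W_def by fastforce
    then show ?thesis using subY by blast
  qed
  ultimately have "es 0 * prod_list gs \<in> Y" by blast
  then show ?thesis
  proof (rule Y_mult[OF _ subS])
    fix w assume "w \<in> W"
    then obtain z n where z: "w = word z 0 (Suc n)" "z 0 = 0" "\<And>r. z r \<le> d"
      by (auto simp: W_def)
    show "w * es 0 \<in> S"
    proof (cases "even n")
      case True
      then have "w * es 0 \<approx> (if 0 = z n then word z 0 (Suc n) else 0)"
        using collapse[where z = z and n = n and x = 0, OF z(3)] z True by simp
      moreover have "(if 0 = z n then word z 0 (Suc n) else 0) \<in> S"
        using corner_word[where z = z, OF S True z(3,2)] subS by (auto simp: A.vs.subspace_0)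
      ultimately show ?thesis using closed_cong[OF subS] by blast
    next
      case False
      then have "w * es 0 = word (z(Suc n := 0)) 0 (Suc (Suc n))"
        using extend[where z = z and n = n and x = 0] z by auto
      also have "\<dots> \<in> S" by (rule corner_word[OF S]) (use False z in auto)
      finally show ?thesis .
    qed
  qed
qed

end

section \<open>The corner algebra as a quotient of a polynomial algebra\<close>

text \<open>
  Applied with \<open>U i l j\<close> saying that \<open>e\<^sub>i e\<^sup>*\<^sub>l e\<^sub>j\<close> and its reversal agree between two copies of \<open>e\<^sup>*\<^sub>0\<close>. The
  elimination runs downwards in \<open>l\<close> and, for fixed \<open>l\<close>, upwards in \<open>j\<close>.
\<close>

lemma symmetric_words:
  fixes U :: "nat \<Rightarrow> nat \<Rightarrow> nat \<Rightarrow> bool"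
  assumes diag: "\<And>i l. U i l i" and sym: "\<And>i l j. U i l j \<Longrightarrow> U j l i"
    and middle: "\<And>i l j K. i \<le> d \<Longrightarrow> j \<le> d \<Longrightarrow> l \<le> d \<Longrightarrow> K \<subseteq> {..d} \<Longrightarrow>
      int (card K) \<le> \<bar>int i - int j\<bar> \<Longrightarrow> (\<And>l. l \<le> d \<Longrightarrow> l \<notin> K \<Longrightarrow> U i l j) \<Longrightarrow> U i l j"
    and left: "\<And>i l j K. i \<le> d \<Longrightarrow> j \<le> d \<Longrightarrow> l \<le> d \<Longrightarrow> K \<subseteq> {..d} \<Longrightarrow>
      card K \<le> l \<Longrightarrow> (\<And>i. i \<le> d \<Longrightarrow> i \<notin> K \<Longrightarrow> U i l j) \<Longrightarrow> U i l j"
    and bounds: "i \<le> d" "l \<le> d" "j \<le> d"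
  shows "U i l j"
proof -
  have "\<forall>l i j. d < l + n \<longrightarrow> l \<le> d \<longrightarrow> i \<le> d \<longrightarrow> j \<le> d \<longrightarrow> U i l j" for n
  proof (induction n)
    case (Suc n)
    have new: "U i l j" if l: "d = l + n" "l \<le> d" and "i \<le> d" "j \<le> d" for l i j
    proof -
      \<comment> \<open>Values above \<open>l\<close> are settled by \<open>Suc.IH\<close>, which
        leaves the \<open>l + 1\<close> values in \<open>{..l}\<close>.\<close>
      have far: "U i l j" if ij: "i \<le> d" "j \<le> d" "int l < \<bar>int i - int j\<bar>" for i j
        by (rule middle[where K = "{..l}"]) (use ij l Suc.IH in auto)
      show ?thesis using \<open>i \<le> d\<close> \<open>j \<le> d\<close>
      proof (induction j arbitrary: i rule: less_induct)
        case (less j)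
        show ?case
        \<comment> \<open>Values of \<open>i\<close> below \<open>j\<close> follow by symmetry from
          the induction on \<open>j\<close>, and those beyond \<open>j + l\<close> from
          \<open>far\<close>; at most \<open>l\<close> values remain unknown.\<close>
        proof (rule left[where K = "{j<..j + l} \<inter> {..d}"])
          show "card ({j<..j + l} \<inter> {..d}) \<le> l"
            using card_mono[of "{j<..j + l}" "{j<..j + l} \<inter> {..d}"] by simp
        next
          fix i assume i: "i \<le> d" "i \<notin> {j<..j + l} \<inter> {..d}"
          consider "i < j" | "i = j" | "j + l < i" using i by fastforce
          then show "U i l j"
          proof cases
            case 1 then show ?thesis using less sym i by auto
          next
            case 2 then show ?thesis using diag by simp
          next
            case 3 then show ?thesis using far less.prems i by auto
          qed
        qed (use less.prems l in auto)
      qed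
    qed
    show ?case
    proof (intro allI impI)
      fix l i j assume "d < l + Suc n" "l \<le> d" "i \<le> d" "j \<le> d"
      then show "U i l j" using new[of l i j] Suc.IH by (cases "d = l + n") auto
    qed
  qed simp
  from this[of "Suc d"] show ?thesis using bounds by auto
qed

lemma degree_tau: "degree (tau \<theta> i) = i"
proof -
  have "degree (\<Prod>h<i. [:- \<theta> h, 1:]) = (\<Sum>h<i. degree [:- \<theta> h, 1:])"
    by (rule degree_prod_sum_eq) auto
  then show ?thesis by (simp add: tau_def)
qed

lemma lead_coeff_tau: "coeff (tau \<theta> i) i = 1"
proof -
  have "lead_coeff (tau \<theta> i) = 1" unfolding tau_def by (simp add: lead_coeff_prod)
  then show ?thesis by (simp add: degree_tau)
qed

lemma poly_mapping_monomials: "F = (\<Sum>m\<in>Poly_Mapping.keys F. Poly_Mapping.single m (Poly_Mapping.lookup F m))"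
  by (rule poly_mapping_eqI) (auto simp: lookup_sum lookup_single when_def sum.delta in_keys_iff)

context two_sided_ideal
begin

lemma commute_mult:
  assumes "x * y \<approx> y * x" "x * z \<approx> z * x"
  shows "x * (y * z) \<approx> y * z * x"
proof -
  have "x * (y * z) \<approx> y * x * z" using cong_mult[OF assms(1) cong_refl[of z]] by (simp add: mult.assoc)
  also have "\<dots> \<approx> y * z * x" using cong_mult[OF cong_refl[of y] assms(2)] by (simp add: mult.assoc)
  finally show ?thesis .
qed

lemma commute_power: "x * y \<approx> y * x \<Longrightarrow> x * y ^ n \<approx> y ^ n * x"
  by (induction n) (auto intro: commute_mult)

end

section \<open>Commutativity of the corner\<close>

context tridiagonal_relations
begin

text \<open>For \<open>middle\<close>, both terms are subject to the tridiagonal relation between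
  \<open>e i\<close> and \<open>e j\<close>. For \<open>left\<close>, the varying idempotent stands
  between \<open>es 0\<close> and \<open>es l\<close> in both terms, in opposite orders, so
  polynomials of degree below \<open>l\<close> give relations.\<close>

lemma symmetric_word:
  assumes "i \<le> d" "l \<le> d" "j \<le> d"
  shows "es 0 * (e i * es l * e j - e j * es l * e i) * es 0 \<in> J"
proof (rule symmetric_words[where d = d, OF _ _ _ _ assms])
  show "es 0 * (e i * es l * e i - e i * es l * e i) * es 0 \<in> J" for i l
    by (simp add: A.zero)
  show "es 0 * (e j * es l * e i - e i * es l * e j) * es 0 \<in> J"
    if "es 0 * (e i * es l * e j - e j * es l * e i) * es 0 \<in> J" for i l j
    using A.diff[OF A.zero that] by (simp add: algebra_simps)
next
  fix i l j K
  assume ij: "i \<le> d" "j \<le> d" and l: "l \<le> d" and K: "K \<subseteq> {..d}" "int (card K) \<le> \<bar>int i - int j\<bar>"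
    and out: "\<And>l. l \<le> d \<Longrightarrow> l \<notin> K \<Longrightarrow> es 0 * (e i * es l * e j - e j * es l * e i) * es 0 \<in> J"
  show "es 0 * (e i * es l * e j - e j * es l * e i) * es 0 \<in> J"
  proof (rule A.vs.interpolation_elim[OF A.subspace_J As.distinct K(1),
        where v = "\<lambda>l. es 0 * (e i * es l * e j - e j * es l * e i) * es 0"])
    show "card K \<le> nat \<bar>int i - int j\<bar>" using K by simp
    fix p :: "'k poly" assume p: "degree p < nat \<bar>int i - int j\<bar>"
    have "es 0 * ((\<Sum>k\<le>d. sc (poly p (\<theta>s k)) * (e i * es k * e j)) -
        (\<Sum>k\<le>d. sc (poly p (\<theta>s k)) * (e j * es k * e i))) * es 0 \<in> J"
      by (intro A.mult_left A.mult_right A.diff As.triple_poly) (use ij p in auto)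
    moreover have "(\<Sum>k\<le>d. sc (poly p (\<theta>s k)) * (es 0 * (e i * es k * e j - e j * es k * e i) * es 0)) =
      es 0 * ((\<Sum>k\<le>d. sc (poly p (\<theta>s k)) * (e i * es k * e j)) -
        (\<Sum>k\<le>d. sc (poly p (\<theta>s k)) * (e j * es k * e i))) * es 0"
      by (simp add: sum_distrib_left sum_distrib_right right_diff_distrib left_diff_distrib
        mult.assoc A.sc_left_commute[of "es 0"] sum_subtractf)
    ultimately show "(\<Sum>k\<le>d. sc (poly p (\<theta>s k)) *
        (es 0 * (e i * es k * e j - e j * es k * e i) * es 0)) \<in> J" by simp
  qed (use out l in auto)
next
  fix i l j K
  assume ij: "i \<le> d" "j \<le> d" and l: "l \<le> d" and K: "K \<subseteq> {..d}" "card K \<le> l"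
    and out: "\<And>i. i \<le> d \<Longrightarrow> i \<notin> K \<Longrightarrow> es 0 * (e i * es l * e j - e j * es l * e i) * es 0 \<in> J"
  show "es 0 * (e i * es l * e j - e j * es l * e i) * es 0 \<in> J"
  proof (rule A.vs.interpolation_elim[OF A.subspace_J A.distinct K,
        where v = "\<lambda>i. es 0 * (e i * es l * e j - e j * es l * e i) * es 0"])
    fix p :: "'k poly" assume p: "degree p < l"
    have "(\<Sum>k\<le>d. sc (poly p (\<theta> k)) * (es 0 * e k * es l)) * (e j * es 0) -
        (es 0 * e j) * (\<Sum>k\<le>d. sc (poly p (\<theta> k)) * (es l * e k * es 0)) \<in> J"
      by (intro A.mult_left A.mult_right A.diff A.triple_poly) (use l p in auto)
    moreover have "(\<Sum>k\<le>d. sc (poly p (\<theta> k)) * (es 0 * (e k * es l * e j - e j * es l * e k) * es 0)) =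
      (\<Sum>k\<le>d. sc (poly p (\<theta> k)) * (es 0 * e k * es l)) * (e j * es 0) -
        (es 0 * e j) * (\<Sum>k\<le>d. sc (poly p (\<theta> k)) * (es l * e k * es 0))"
      by (simp add: sum_distrib_left sum_distrib_right right_diff_distrib left_diff_distrib
        mult.assoc A.sc_left_commute[of "es 0"] A.sc_left_commute[of "e j"] sum_subtractf)
    ultimately show "(\<Sum>k\<le>d. sc (poly p (\<theta> k)) *
        (es 0 * (e k * es l * e j - e j * es l * e k) * es 0)) \<in> J" by simp
  qed (use out ij in auto)
qed

lemma corner_idempotents_commute:
  assumes "i \<le> d" "j \<le> d"
  shows "(es 0 * e i * es 0) * (es 0 * e j * es 0) \<approx> (es 0 * e j * es 0) * (es 0 * e i * es 0)"
proof -
  have red: "(es 0 * e i * es 0) * (es 0 * e j * es 0) \<approx> es 0 * (e i * es 0 * e j) * es 0" for i j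
  proof -
    have "(es 0 * e i) * (es 0 * es 0) * (e j * es 0) \<approx> (es 0 * e i) * es 0 * (e j * es 0)"
      by (intro A.cong_mult A.cong_refl A.cong_sym[OF es0_idem])
    then show ?thesis by (simp add: mult.assoc)
  qed
  have "es 0 * (e i * es 0 * e j) * es 0 \<approx> es 0 * (e j * es 0 * e i) * es 0"
    using symmetric_word[of i 0 j] assms
    by (simp add: A.cong_def right_diff_distrib left_diff_distrib)
  then show ?thesis using red A.cong_sym A.cong_trans by meson
qed

lemma corner_ev: "es 0 * A.ev p a * es 0 \<approx> (\<Sum>i\<le>d. sc (poly p (\<theta> i)) * (es 0 * e i * es 0))"
proof -
  have "es 0 * A.ev p a * es 0 \<approx> es 0 * (\<Sum>i\<le>d. sc (poly p (\<theta> i)) * e i) * es 0"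
    by (intro A.cong_mult A.cong_refl A.ev_spectral)
  then show ?thesis
    by (simp add: sum_distrib_left sum_distrib_right mult.assoc A.sc_left_commute[of "es 0"])
qed

lemma corner_ev_commute:
  "(es 0 * A.ev p a * es 0) * (es 0 * A.ev q a * es 0) \<approx> (es 0 * A.ev q a * es 0) * (es 0 * A.ev p a * es 0)"
proof -
  define c where "c = (\<lambda>i. es 0 * e i * es 0)"
  have prod: "(es 0 * A.ev p a * es 0) * (es 0 * A.ev q a * es 0) \<approx>
    (\<Sum>i\<le>d. \<Sum>j\<le>d. sc (poly p (\<theta> i) * poly q (\<theta> j)) * (c i * c j))" for p q
  proof -
    have "(es 0 * A.ev p a * es 0) * (es 0 * A.ev q a * es 0) \<approx>
      (\<Sum>i\<le>d. sc (poly p (\<theta> i)) * c i) * (\<Sum>j\<le>d. sc (poly q (\<theta> j)) * c j)"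
      unfolding c_def by (intro A.cong_mult corner_ev)
    then show ?thesis
      by (simp add: sum_product mult.assoc A.sc_left_commute[of "c _"])
  qed
  have "(es 0 * A.ev p a * es 0) * (es 0 * A.ev q a * es 0) \<approx>
    (\<Sum>i\<le>d. \<Sum>j\<le>d. sc (poly p (\<theta> i) * poly q (\<theta> j)) * (c j * c i))"
    by (rule A.cong_trans[OF prod], intro A.cong_sum, rule A.cong_mult[OF A.cong_refl])
      (simp add: c_def corner_idempotents_commute)
  also have "\<dots> = (\<Sum>i\<le>d. \<Sum>j\<le>d. sc (poly q (\<theta> i) * poly p (\<theta> j)) * (c i * c j))"
    by (subst sum.swap) (simp add: mult.commute)
  also have "\<dots> \<approx> (es 0 * A.ev q a * es 0) * (es 0 * A.ev p a * es 0)"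
    by (rule A.cong_sym[OF prod])
  finally show ?thesis .
qed

section \<open>Lifting the homomorphism to the ring, and its range\<close>

definition corner_gen :: "nat \<Rightarrow> 'r" where
  "corner_gen r = es 0 * A.ev (tau \<theta> r) a * es 0"

definition mon_upto :: "nat \<Rightarrow> (nat \<Rightarrow>\<^sub>0 nat) \<Rightarrow> 'r" where
  "mon_upto k m = prod_list (map (\<lambda>i. corner_gen i ^ Poly_Mapping.lookup m i) [1..<Suc k])"

text \<open>An empty product is 1 in the ambient ring, whereas the corner has identity
  \<open>es 0\<close>; the leading factor makes up for this.\<close>

definition mon :: "(nat \<Rightarrow>\<^sub>0 nat) \<Rightarrow> 'r" where
  "mon m = es 0 * mon_upto d m"

lemma mon_upto_simps [simp]:
  "mon_upto 0 m = 1"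
  "mon_upto (Suc k) m = mon_upto k m * corner_gen (Suc k) ^ Poly_Mapping.lookup m (Suc k)"
  by (simp_all add: mon_upto_def)

lemma es0_corner: "es 0 * (es 0 * x * es 0) \<approx> es 0 * x * es 0" "(es 0 * x * es 0) * es 0 \<approx> es 0 * x * es 0"
  using A.cong_mult[OF A.cong_sym[OF es0_idem] A.cong_refl[of "x * es 0"]]
    A.cong_mult[OF A.cong_refl[of "es 0 * x"] A.cong_sym[OF es0_idem]]
  by (simp_all add: mult.assoc)

lemma commute_mon_upto:
  assumes "\<And>i. x * corner_gen i \<approx> corner_gen i * x"
  shows "x * mon_upto k m \<approx> mon_upto k m * x"
  by (induction k) (auto intro: A.commute_mult A.commute_power assms)

lemma mon_upto_add: "mon_upto k (m + n) \<approx> mon_upto k m * mon_upto k n"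
proof (induction k)
  case (Suc k)
  let ?g = "corner_gen (Suc k)"
  let ?x = "?g ^ Poly_Mapping.lookup m (Suc k)" and ?y = "?g ^ Poly_Mapping.lookup n (Suc k)"
  have comm: "mon_upto k n * ?x \<approx> ?x * mon_upto k n"
    by (rule A.commute_power, rule A.cong_sym, rule commute_mon_upto)
      (simp add: corner_gen_def corner_ev_commute)
  have "mon_upto (Suc k) (m + n) \<approx> mon_upto k m * mon_upto k n * (?x * ?y)"
    using A.cong_mult[OF Suc A.cong_refl] by (simp add: lookup_add power_add)
  also have "\<dots> = mon_upto k m * (mon_upto k n * ?x) * ?y" by (simp add: mult.assoc)
  also have "\<dots> \<approx> mon_upto k m * (?x * mon_upto k n) * ?y"
    by (rule A.cong_mult[OF A.cong_mult[OF A.cong_refl comm] A.cong_refl])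
  finally show ?case by (simp add: mult.assoc)
qed simp

lemma mon_add: "mon (m + n) \<approx> mon m * mon n"
proof -
  have comm: "es 0 * mon_upto d m \<approx> mon_upto d m * es 0"
    by (rule commute_mon_upto) (use es0_corner A.cong_sym A.cong_trans in \<open>unfold corner_gen_def, blast\<close>)
  have "mon (m + n) \<approx> es 0 * es 0 * (mon_upto d m * mon_upto d n)"
    unfolding mon_def by (intro A.cong_mult es0_idem mon_upto_add)
  also have "\<dots> = es 0 * (es 0 * mon_upto d m) * mon_upto d n" by (simp add: mult.assoc)
  also have "\<dots> \<approx> es 0 * (mon_upto d m * es 0) * mon_upto d n"
    by (rule A.cong_mult[OF A.cong_mult[OF A.cong_refl comm] A.cong_refl])
  finally show ?thesis by (simp add: mon_def mult.assoc)
qed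

lemma mon_0: "mon 0 = es 0"
proof -
  have "mon_upto k 0 = 1" for k by (induction k) auto
  then show ?thesis by (simp add: mon_def)
qed

lemma mon_single:
  assumes "1 \<le> i" "i \<le> d"
  shows "mon (Poly_Mapping.single i 1) \<approx> corner_gen i"
proof -
  have "mon_upto k (Poly_Mapping.single i 1) = (if i \<le> k then corner_gen i else 1)" for k
    using assms(1) by (induction k) (auto simp: lookup_single when_def le_Suc_eq)
  then show ?thesis using assms(2) es0_corner by (simp add: mon_def corner_gen_def)
qed

text \<open>A lift of the homomorphism before passing to the quotient. It is exactly additive, while
  multiplicativity is established modulo \<open>J\<close>.\<close>

definition Phi :: "((nat \<Rightarrow>\<^sub>0 nat) \<Rightarrow>\<^sub>0 'k) \<Rightarrow> 'r" where
  "Phi F = (\<Sum>m\<in>Poly_Mapping.keys F. sc (Poly_Mapping.lookup F m) * mon m)"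

lemma Phi_superset:
  assumes "finite M" "Poly_Mapping.keys F \<subseteq> M"
  shows "Phi F = (\<Sum>m\<in>M. sc (Poly_Mapping.lookup F m) * mon m)"
  unfolding Phi_def using assms by (intro sum.mono_neutral_left) (auto simp: in_keys_iff)

lemma Phi_add: "Phi (F + G) = Phi F + Phi G"
proof -
  let ?M = "Poly_Mapping.keys F \<union> Poly_Mapping.keys G"
  have "Poly_Mapping.keys (F + G) \<subseteq> ?M" by (rule Poly_Mapping.keys_add)
  then show ?thesis
    by (simp add: Phi_superset[of ?M] lookup_add A.sc_add distrib_right sum.distrib)
qed

lemma Phi_single: "Phi (Poly_Mapping.single m c) = sc c * mon m"
  by (simp add: Phi_def)

lemma Phi_sum: "Phi (sum F X) = (\<Sum>x\<in>X. Phi (F x))"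
  by (induction X rule: infinite_finite_induct) (auto simp: Phi_add Phi_def[of 0])

lemma Phi_1: "Phi 1 = es 0"
  using Phi_single[of 0 1] by (simp add: mon_0)

lemma Phi_mult: "Phi (F * G) \<approx> Phi F * Phi G"
proof -
  let ?F = "Poly_Mapping.keys F" and ?G = "Poly_Mapping.keys G"
  have "F * G = (\<Sum>m\<in>?F. Poly_Mapping.single m (Poly_Mapping.lookup F m)) * (\<Sum>n\<in>?G. Poly_Mapping.single n (Poly_Mapping.lookup G n))"
    using poly_mapping_monomials[of F] poly_mapping_monomials[of G] by simp
  then have "F * G = (\<Sum>m\<in>?F. \<Sum>n\<in>?G. Poly_Mapping.single (m + n) (Poly_Mapping.lookup F m * Poly_Mapping.lookup G n))"
    by (simp add: sum_product mult_single)
  then have "Phi (F * G) = (\<Sum>m\<in>?F. \<Sum>n\<in>?G. sc (Poly_Mapping.lookup F m * Poly_Mapping.lookup G n) * mon (m + n))"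
    by (simp add: Phi_sum Phi_single)
  also have "\<dots> \<approx> (\<Sum>m\<in>?F. \<Sum>n\<in>?G. sc (Poly_Mapping.lookup F m * Poly_Mapping.lookup G n) * (mon m * mon n))"
    by (intro A.cong_sum A.cong_mult A.cong_refl mon_add)
  also have "\<dots> = Phi F * Phi G"
    by (simp add: Phi_def sum_product mult.assoc A.sc_left_commute[of "mon _"])
  finally show ?thesis .
qed

lemma Phi_scale: "Phi (Poly_Mapping.single 0 c * F) \<approx> sc c * Phi F"
proof -
  have "Phi (Poly_Mapping.single 0 c * F) \<approx> sc c * es 0 * Phi F"
    using Phi_mult[of "Poly_Mapping.single 0 c" F] by (simp add: Phi_single mon_0)
  also have "\<dots> = (\<Sum>m\<in>Poly_Mapping.keys F. sc c * (sc (Poly_Mapping.lookup F m) * (es 0 * mon m)))"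
    by (simp add: Phi_def sum_distrib_left mult.assoc A.sc_left_commute[of "es 0"])
  also have "\<dots> \<approx> (\<Sum>m\<in>Poly_Mapping.keys F. sc c * (sc (Poly_Mapping.lookup F m) * mon m))"
  proof (intro A.cong_sum A.cong_mult A.cong_refl)
    fix m show "es 0 * mon m \<approx> mon m"
      using A.cong_mult[OF A.cong_sym[OF es0_idem] A.cong_refl] by (simp add: mon_def mult.assoc)
  qed
  also have "\<dots> = sc c * Phi F" by (simp add: Phi_def sum_distrib_left)
  finally show ?thesis .
qed

definition polys :: "((nat \<Rightarrow>\<^sub>0 nat) \<Rightarrow>\<^sub>0 'k) set" where
  "polys = {F. Poly_Mapping.keys F \<subseteq> {m. Poly_Mapping.keys m \<subseteq> {1..d}}}"

lemma polys_closed: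
  "Poly_Mapping.single 0 c \<in> polys" "F \<in> polys \<Longrightarrow> G \<in> polys \<Longrightarrow> F + G \<in> polys"
  "F \<in> polys \<Longrightarrow> G \<in> polys \<Longrightarrow> F * G \<in> polys"
  "1 \<le> i \<Longrightarrow> i \<le> d \<Longrightarrow> Poly_Mapping.single (Poly_Mapping.single i 1) c \<in> polys"
proof -
  show "F + G \<in> polys" if "F \<in> polys" "G \<in> polys"
    using that Poly_Mapping.keys_add[of F G] by (auto simp: polys_def)
  show "F * G \<in> polys" if "F \<in> polys" "G \<in> polys"
  proof -
    have "Poly_Mapping.keys m \<subseteq> {1..d}" if m: "m \<in> Poly_Mapping.keys (F * G)" for m
    proof -
      obtain x y where "m = x + y" "x \<in> Poly_Mapping.keys F" "y \<in> Poly_Mapping.keys G"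
        using keys_mult[of F G] m by blast
      then show ?thesis
        using Poly_Mapping.keys_add[of x y] \<open>F \<in> polys\<close> \<open>G \<in> polys\<close> by (auto simp: polys_def)
    qed
    then show ?thesis by (auto simp: polys_def)
  qed
qed (auto simp: polys_def split: if_splits)

text \<open>Saturated by \<open>J\<close>, so that it can serve as \<open>S\<close> in
  \<open>corner_generated\<close>.\<close>

definition Phi_range :: "'r set" where
  "Phi_range = {x. \<exists>F\<in>polys. x \<approx> Phi F}"

lemma Phi_rangeI: "F \<in> polys \<Longrightarrow> x \<approx> Phi F \<Longrightarrow> x \<in> Phi_range"
  by (auto simp: Phi_range_def)

lemma subspace_Phi_range: "A.vs.subspace Phi_range" "J \<subseteq> Phi_range"
proof -
  have 0: "Phi 0 = 0" "0 \<in> polys" by (simp_all add: Phi_def polys_def)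
  show "J \<subseteq> Phi_range"
    using 0 Phi_rangeI[of 0] A.cong_0_iff by auto
  then have "0 \<in> Phi_range" using A.zero by blast
  moreover have "x + y \<in> Phi_range" if "x \<in> Phi_range" "y \<in> Phi_range" for x y
  proof -
    obtain F G where "F \<in> polys" "x \<approx> Phi F" "G \<in> polys" "y \<approx> Phi G"
      using \<open>x \<in> Phi_range\<close> \<open>y \<in> Phi_range\<close> by (auto simp: Phi_range_def)
    then show ?thesis by (intro Phi_rangeI[of "F + G"]) (auto simp: polys_closed Phi_add intro: A.cong_add)
  qed
  moreover have "sc c * x \<in> Phi_range" if "x \<in> Phi_range" for c x
  proof -
    obtain F where F: "F \<in> polys" "x \<approx> Phi F"
      using \<open>x \<in> Phi_range\<close> by (auto simp: Phi_range_def)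
    have "sc c * x \<approx> sc c * Phi F" by (intro A.cong_mult A.cong_refl F)
    also have "\<dots> \<approx> Phi (Poly_Mapping.single 0 c * F)" by (rule A.cong_sym[OF Phi_scale])
    finally show ?thesis by (intro Phi_rangeI[of "Poly_Mapping.single 0 c * F"]) (auto simp: polys_closed F)
  qed
  ultimately show "A.vs.subspace Phi_range" by (auto simp: A.vs.subspace_def)
qed

text \<open>\<open>tau \<theta> n\<close> is monic of degree \<open>n\<close>, so a multiple of
  \<open>corner_gen n\<close> removes the leading term of \<open>p\<close>; the bound
  \<open>n \<le> d\<close> ensures that this generator is the image of a variable.\<close>

lemma ev_in_Phi_range:
  assumes "degree p \<le> n" "n \<le> d"
  shows "es 0 * A.ev p a * es 0 \<in> Phi_range"
  using assms
proof (induction n arbitrary: p)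
  case 0
  then have "es 0 * A.ev p a * es 0 = sc (coeff p 0) * (es 0 * es 0)"
    by (simp add: A.ev_def A.sc_left_commute[of "es 0"] mult.assoc flip: A.sc_central)
  also have "\<dots> \<approx> sc (coeff p 0) * es 0"
    by (intro A.cong_mult A.cong_refl A.cong_sym[OF es0_idem])
  also have "\<dots> = Phi (Poly_Mapping.single 0 (coeff p 0))" by (simp add: Phi_single mon_0)
  finally show ?case by (intro Phi_rangeI) (auto simp: polys_closed)
next
  case (Suc n)
  define c where "c = coeff p (Suc n)"
  define q where "q = p - Polynomial.smult c (tau \<theta> (Suc n))"
  have "degree q \<le> Suc n"
    unfolding q_def using Suc.prems
    by (intro degree_diff_le) (auto intro: order_trans[OF degree_smult_le] simp: degree_tau)
  moreover have "coeff q (Suc n) = 0" by (simp add: q_def c_def lead_coeff_tau)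
  ultimately have "degree q \<le> n" by (metis eq_zero_or_degree_less le_SucE le_zero_eq degree_0 leading_coeff_0_iff zero_le)
  then have q: "es 0 * A.ev q a * es 0 \<in> Phi_range" using Suc by simp
  have "corner_gen (Suc n) \<approx> Phi (Poly_Mapping.single (Poly_Mapping.single (Suc n) 1) 1)"
    using mon_single[of "Suc n"] Suc.prems by (simp add: Phi_single A.cong_sym)
  then have g: "corner_gen (Suc n) \<in> Phi_range"
    by (rule Phi_rangeI[OF polys_closed(4), rotated 2]) (use Suc.prems in auto)
  have "p = q + Polynomial.smult c (tau \<theta> (Suc n))" by (simp add: q_def)
  then have "es 0 * A.ev p a * es 0 = es 0 * A.ev q a * es 0 + sc c * corner_gen (Suc n)"
    by (simp add: A.ev_add A.ev_smult corner_gen_def distrib_left distrib_right mult.assoc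
      A.sc_left_commute[of "es 0"])
  then show ?case
    using q g subspace_Phi_range(1) by (simp add: A.vs.subspace_add A.vs.subspace_scale)
qed

text \<open>Products are handled by \<open>Phi_mult\<close>. Modulo \<open>J\<close>,
  \<open>e i\<close> is the value at \<open>a\<close> of the Lagrange polynomial \<open>p\<close>
  for the nodes \<open>\<theta> j\<close>, whose degree is at most \<open>d\<close>.\<close>

lemma corner_closed_Phi_range: "corner_closed Phi_range"
  unfolding corner_closed_def
proof (intro conjI subspace_Phi_range ballI allI impI)
  fix x y assume "x \<in> Phi_range" "y \<in> Phi_range"
  then obtain F G where FG: "F \<in> polys" "x \<approx> Phi F" "G \<in> polys" "y \<approx> Phi G"
    by (auto simp: Phi_range_def)
  have "x * y \<approx> Phi F * Phi G" by (intro A.cong_mult FG)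
  also have "\<dots> \<approx> Phi (F * G)" by (rule A.cong_sym[OF Phi_mult])
  finally show "x * y \<in> Phi_range" using FG by (intro Phi_rangeI) (auto intro: polys_closed)
next
  fix i assume i: "i \<le> d"
  define q where "q = (\<Prod>j\<in>{..d} - {i}. [:- \<theta> j, 1:])"
  define p where "p = Polynomial.smult (inverse (poly q (\<theta> i))) q"
  have "poly q (\<theta> i) \<noteq> 0"
    using A.distinct i by (auto simp: q_def poly_prod inj_on_def)
  moreover have "poly q (\<theta> j) = 0" if "j \<le> d" "j \<noteq> i" for j
    using that by (auto simp: q_def poly_prod)
  ultimately have p: "poly p (\<theta> j) = (if j = i then 1 else 0)" if "j \<le> d" for j
    using that by (auto simp: p_def)
  have "degree q = (\<Sum>j\<in>{..d} - {i}. degree [:- \<theta> j, 1:])"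
    unfolding q_def by (rule degree_prod_sum_eq) auto
  then have "degree p \<le> d" using i by (auto simp: p_def intro: order_trans[OF degree_smult_le])
  then have "es 0 * A.ev p a * es 0 \<in> Phi_range" by (rule ev_in_Phi_range) simp
  moreover have "(\<Sum>j\<le>d. sc (poly p (\<theta> j)) * (es 0 * e j * es 0)) = es 0 * e i * es 0"
  proof -
    have "(\<Sum>j\<le>d. sc (poly p (\<theta> j)) * (es 0 * e j * es 0)) =
      (\<Sum>j\<le>d. if j = i then es 0 * e j * es 0 else 0)"
      by (intro sum.cong) (auto simp: p)
    then show ?thesis using i by simp
  qed
  ultimately show "es 0 * e i * es 0 \<in> Phi_range"
    using corner_ev[of p] closed_cong[OF subspace_Phi_range] A.cong_sym by metis
qed

end

section \<open>Representations of the free algebra\<close>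

context ambient_space
begin

lemma endo_closed: "endo V f \<Longrightarrow> v \<in> V \<Longrightarrow> f v \<in> V"
  by (simp add: endo_def)

lemma endo_add: "endo V f \<Longrightarrow> v \<in> V \<Longrightarrow> w \<in> V \<Longrightarrow> f (v + w) = f v + f w"
  by (simp add: endo_def)

lemma endo_scale: "endo V f \<Longrightarrow> v \<in> V \<Longrightarrow> f (scale c v) = scale c (f v)"
  by (simp add: endo_def)

lemma endo_0: "endo V f \<Longrightarrow> subspace V \<Longrightarrow> f 0 = 0"
  using endo_scale[of V f 0 0] by (simp add: subspace_0)

lemma endo_sum:
  assumes "endo V f" "subspace V" "\<And>i. i \<in> I \<Longrightarrow> v i \<in> V"
  shows "f (sum v I) = (\<Sum>i\<in>I. f (v i))"
  using assms(3)
proof (induction I rule: infinite_finite_induct)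
  case (insert i I)
  then show ?case using endo_add[OF assms(1)] subspace_sum[OF assms(2), of I v] by simp
qed (simp_all add: endo_0[OF assms(1,2)])

lemma endo_linear_combination:
  assumes "subspace V" "\<And>i. i \<in> I \<Longrightarrow> endo V (f i)"
  shows "endo V (\<lambda>v. \<Sum>i\<in>I. scale (c i) (f i v))"
  unfolding endo_def
proof (intro conjI ballI allI)
  fix v assume v: "v \<in> V"
  show "(\<Sum>i\<in>I. scale (c i) (f i v)) \<in> V"
    by (intro subspace_sum[OF assms(1)] subspace_scale[OF assms(1)] endo_closed[OF assms(2)] v)
  show "(\<Sum>i\<in>I. scale (c i) (f i (scale a v))) = scale a (\<Sum>i\<in>I. scale (c i) (f i v))" for a
    unfolding scale_sum_right
    by (intro sum.cong refl) (simp add: endo_scale[OF assms(2) v] mult.commute)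
  fix w assume w: "w \<in> V"
  show "(\<Sum>i\<in>I. scale (c i) (f i (v + w))) = (\<Sum>i\<in>I. scale (c i) (f i v)) + (\<Sum>i\<in>I. scale (c i) (f i w))"
    unfolding sum.distrib[symmetric]
    by (intro sum.cong refl) (simp add: endo_add[OF assms(2) v w] scale_right_distrib)
qed

text \<open>Everything is checked on the eigenspaces \<open>W i\<close>, which span
  \<open>V\<close>: \<open>E i\<close> fixes \<open>W i\<close> and kills the others. For the
  tridiagonal relation, \<open>g ^^ k\<close> moves \<open>W j\<close> only into eigenspaces whose
  index is within distance \<open>k\<close> of \<open>j\<close>.\<close>

lemma standard_idempotents_relations:
  assumes V: "subspace V" and f: "endo V f" and g: "endo V g" and diag: "diagonalizable V f"
    and st: "standard_idempotents V f g d E" and ev: "eigenvalue_sequence V d f E \<theta>"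
  shows "\<And>i. i \<le> d \<Longrightarrow> endo V (E i)"
    and "\<And>i j v. i \<le> d \<Longrightarrow> j \<le> d \<Longrightarrow> v \<in> V \<Longrightarrow> E i (E j v) = (if i = j then E i v else 0)"
    and "\<And>v. v \<in> V \<Longrightarrow> (\<Sum>i\<le>d. E i v) = v"
    and "\<And>v. v \<in> V \<Longrightarrow> f v = (\<Sum>i\<le>d. scale (\<theta> i) (E i v))"
    and "\<And>i j k v. i \<le> d \<Longrightarrow> j \<le> d \<Longrightarrow> int k < \<bar>int i - int j\<bar> \<Longrightarrow> v \<in> V \<Longrightarrow> E i ((g ^^ k) (E j v)) = 0"
    and "\<And>i. i \<le> d \<Longrightarrow> \<exists>v\<in>V. v \<noteq> 0 \<and> E i v = v"
proof -
  obtain W where so: "standard_ordering V f g d W"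
    and prim: "\<And>i. i \<le> d \<Longrightarrow> primitive_idempotent V f (W i) (E i)"
    using st by (auto simp: standard_idempotents_def)
  have bij: "bij_betw W {..d} (eigenspaces V f)"
    using so by (simp add: standard_ordering_def)
  have WE: "W i \<in> eigenspaces V f" if "i \<le> d" for i
    using bij that by (auto simp: bij_betw_def)
  have Winj: "W i = W j \<longleftrightarrow> i = j" if "i \<le> d" "j \<le> d" for i j
    using bij that by (auto simp: bij_betw_def inj_on_def)
  show E: "endo V (E i)" if "i \<le> d" for i
    using prim[OF that] by (simp add: primitive_idempotent_def)
  have Wsub: "subspace (W i)" "W i \<subseteq> V" if i: "i \<le> d" for i
  proof -
    obtain c where c: "W i = {v \<in> V. f v = scale c v}"
      using WE[OF i] by (auto simp: eigenspaces_def)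
    show "W i \<subseteq> V" using c by auto
    show "subspace (W i)"
      unfolding c using V f endo_0[OF f V]
      by (auto simp: subspace_def endo_add endo_scale scale_right_distrib mult.commute)
  qed
  have EW: "E i v = (if i = j then v else 0)" if "i \<le> d" "j \<le> d" "v \<in> W j" for i j v
    using prim[OF that(1)] WE[OF that(2)] Winj[OF that(1,2)] that(3)
    by (auto simp: primitive_idempotent_def)
  have V_span: "v \<in> X" if "v \<in> V" "subspace X" "\<And>i. i \<le> d \<Longrightarrow> W i \<subseteq> X" for v X
  proof -
    have "\<Union>(eigenspaces V f) = (\<Union>i\<le>d. W i)" using bij by (auto simp: bij_betw_def)
    then have "span (\<Union>i\<le>d. W i) = V" using diag by (simp add: diagonalizable_def)
    moreover have "span (\<Union>i\<le>d. W i) \<subseteq> X" by (rule span_minimal) (use that in auto)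
    ultimately show ?thesis using that(1) by blast
  qed
  have ext: "P v = Q v" if v: "v \<in> V" and P: "endo V P" and Q: "endo V Q"
    and eq: "\<And>i w. i \<le> d \<Longrightarrow> w \<in> W i \<Longrightarrow> P w = Q w" for v P Q
  proof -
    have "v \<in> {v \<in> V. P v = Q v}"
    proof (rule V_span[OF v])
      show "subspace {v \<in> V. P v = Q v}"
        using V P Q endo_0[OF P V] endo_0[OF Q V]
        by (auto simp: subspace_def endo_add endo_scale)
      show "W i \<subseteq> {v \<in> V. P v = Q v}" if "i \<le> d" for i
        using Wsub(2)[OF that] eq[OF that] by auto
    qed
    then show ?thesis by simp
  qed
  have range_E: "E i v \<in> W i" if i: "i \<le> d" and v: "v \<in> V" for i v
  proof -
    have "v \<in> {v \<in> V. E i v \<in> W i}"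
    proof (rule V_span[OF v])
      show "subspace {v \<in> V. E i v \<in> W i}"
        using V Wsub(1)[OF i] E[OF i] endo_0[OF E[OF i] V]
        by (auto simp: subspace_def endo_add endo_scale)
      show "W j \<subseteq> {v \<in> V. E i v \<in> W i}" if "j \<le> d" for j
        using EW[OF i that] Wsub[OF that] Wsub(1)[OF i] by (auto simp: subspace_0)
    qed
    then show ?thesis by simp
  qed
  show "E i (E j v) = (if i = j then E i v else 0)" if "i \<le> d" "j \<le> d" "v \<in> V" for i j v
    using EW[OF that(1,2) range_E[OF that(2,3)]] by auto
  have single: "(\<Sum>i\<le>d. scale (c i) (E i w)) = scale (c j) w" if "j \<le> d" "w \<in> W j" for c j w
  proof -
    have "(\<Sum>i\<le>d. scale (c i) (E i w)) = (\<Sum>i\<le>d. if i = j then scale (c j) w else 0)"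
      by (intro sum.cong refl) (use EW[OF _ that] in auto)
    then show ?thesis using that by simp
  qed
  have lin: "endo V (\<lambda>v. \<Sum>i\<le>d. scale (c i) (E i v))" for c
    by (rule endo_linear_combination[OF V]) (use E in auto)
  show "(\<Sum>i\<le>d. E i v) = v" if "v \<in> V" for v
  proof -
    have "(\<Sum>i\<le>d. scale 1 (E i v)) = id v"
      using single[where c = "\<lambda>_. 1"] by (intro ext[OF that lin]) (auto simp: endo_def)
    then show ?thesis by simp
  qed
  show "f v = (\<Sum>i\<le>d. scale (\<theta> i) (E i v))" if "v \<in> V" for v
  proof (rule ext[OF that f lin])
    fix i w assume i: "i \<le> d" and w: "w \<in> W i"
    then have "w \<in> E i ` V" using EW[OF i i w] Wsub[OF i] by (auto intro!: image_eqI[of w "E i" w])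
    then have "f w = scale (\<theta> i) w" using ev i by (auto simp: eigenvalue_sequence_def)
    then show "f w = (\<Sum>i\<le>d. scale (\<theta> i) (E i w))" using single[OF i w] by simp
  qed
  show "\<exists>v\<in>V. v \<noteq> 0 \<and> E i v = v" if i: "i \<le> d" for i
  proof -
    have "W i \<noteq> {0}" using WE[OF i] by (auto simp: eigenspaces_def)
    moreover have "0 \<in> W i" using Wsub(1)[OF i] by (rule subspace_0)
    ultimately obtain v where "v \<in> W i" "v \<noteq> 0" by auto
    then show ?thesis using EW[OF i i] Wsub(2)[OF i] by auto
  qed
  define near where "near = (\<lambda>j k. \<Union>l\<in>{l. l \<le> d \<and> \<bar>int l - int j\<bar> \<le> int k}. W l)"
  have near_V: "span (near j k) \<subseteq> V" for j k
    by (rule span_minimal) (use Wsub V in \<open>auto simp: near_def\<close>)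
  have band: "(g ^^ k) w \<in> span (near j k)" if j: "j \<le> d" and w: "w \<in> W j" for j k w
  proof (induction k)
    case 0
    then show ?case using j w by (auto simp: near_def intro: span_base)
  next
    case (Suc k)
    have "near j k \<subseteq> {v \<in> V. g v \<in> span (near j (Suc k))}"
    proof
      fix x assume "x \<in> near j k"
      then obtain l where l: "l \<le> d" "\<bar>int l - int j\<bar> \<le> int k" "x \<in> W l" by (auto simp: near_def)
      have "g x \<in> span (\<Union>i\<in>{i. i \<le> d \<and> l \<le> i + 1 \<and> i \<le> l + 1}. W i)"
        using so l by (auto simp: standard_ordering_def)
      also have "\<dots> \<subseteq> span (near j (Suc k))"
        by (rule span_mono) (use l in \<open>auto simp: near_def\<close>)
      finally show "x \<in> {v \<in> V. g v \<in> span (near j (Suc k))}" using l Wsub by auto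
    qed
    moreover have "subspace {v \<in> V. g v \<in> span (near j (Suc k))}"
      using V g endo_0[OF g V]
      by (auto simp: subspace_def endo_add endo_scale span_add span_scale span_zero)
    ultimately have "span (near j k) \<subseteq> {v \<in> V. g v \<in> span (near j (Suc k))}"
      by (rule span_minimal)
    then show ?case using Suc by auto
  qed
  show "E i ((g ^^ k) (E j v)) = 0"
    if i: "i \<le> d" and j: "j \<le> d" and k: "int k < \<bar>int i - int j\<bar>" and v: "v \<in> V" for i j k v
  proof -
    have "near j k \<subseteq> {v \<in> V. E i v = 0}"
      using EW[OF i] Wsub k by (fastforce simp: near_def)
    moreover have "subspace {v \<in> V. E i v = 0}"
      using V E[OF i] endo_0[OF E[OF i] V] by (auto simp: subspace_def endo_add endo_scale)
    ultimately have "span (near j k) \<subseteq> {v \<in> V. E i v = 0}" by (rule span_minimal)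
    then show ?thesis using band[OF j range_E[OF j v]] by blast
  qed
qed

end

locale word_action = ambient_space scale
  for scale :: "'a::field \<Rightarrow> 'b::ab_group_add \<Rightarrow> 'b" +
  fixes V :: "'b set" and act :: "gen \<Rightarrow> 'b \<Rightarrow> 'b"
  assumes subspace_V: "subspace V" and endo_act: "endo V (act g)"
begin

definition word_act :: "gen list \<Rightarrow> 'b \<Rightarrow> 'b" where
  "word_act w = foldr act w"

lemma endo_word_act: "endo V (word_act w)"
  unfolding word_act_def using endo_act by (induction w) (auto simp: endo_def)

lemma word_act_add: "word_act (u + w) v = word_act u (word_act w v)"
  by (simp add: word_act_def plus_list_def)

definition rep :: "(gen list \<Rightarrow>\<^sub>0 'a) \<Rightarrow> 'b \<Rightarrow> 'b" where
  "rep f v = (\<Sum>w\<in>Poly_Mapping.keys f. scale (Poly_Mapping.lookup f w) (word_act w v))"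

lemma rep_superset:
  assumes "finite M" "Poly_Mapping.keys f \<subseteq> M"
  shows "rep f v = (\<Sum>w\<in>M. scale (Poly_Mapping.lookup f w) (word_act w v))"
  unfolding rep_def using assms by (intro sum.mono_neutral_left) (auto simp: in_keys_iff)

lemma rep_add: "rep (f + g) v = rep f v + rep g v"
proof -
  let ?M = "Poly_Mapping.keys f \<union> Poly_Mapping.keys g"
  have "Poly_Mapping.keys (f + g) \<subseteq> ?M" by (rule Poly_Mapping.keys_add)
  then show ?thesis
    by (simp add: rep_superset[of ?M] lookup_add scale_left_distrib sum.distrib)
qed

lemma rep_0 [simp]: "rep 0 v = 0"
  by (simp add: rep_def)

lemma rep_diff: "rep (f - g) v = rep f v - rep g v"
  using rep_add[of "f - g" g v] by simp

lemma rep_sum: "rep (sum f X) v = (\<Sum>x\<in>X. rep (f x) v)"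
  by (induction X rule: infinite_finite_induct) (auto simp: rep_add)

lemma rep_single: "rep (Poly_Mapping.single w c) v = scale c (word_act w v)"
  by (simp add: rep_def)

lemma endo_rep: "endo V (rep f)"
  unfolding rep_def[abs_def] by (rule endo_linear_combination[OF subspace_V endo_word_act])

lemma rep_closed: "v \<in> V \<Longrightarrow> rep f v \<in> V"
  by (rule endo_closed[OF endo_rep])

lemma rep_mult:
  assumes v: "v \<in> V"
  shows "rep (f * g) v = rep f (rep g v)"
proof -
  let ?F = "Poly_Mapping.keys f" and ?G = "Poly_Mapping.keys g"
  let ?f = "Poly_Mapping.lookup f" and ?g = "Poly_Mapping.lookup g"
  have "f * g = (\<Sum>u\<in>?F. Poly_Mapping.single u (?f u)) * (\<Sum>w\<in>?G. Poly_Mapping.single w (?g w))"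
    using poly_mapping_monomials[of f] poly_mapping_monomials[of g] by simp
  then have "rep (f * g) v = (\<Sum>u\<in>?F. \<Sum>w\<in>?G. scale (?f u * ?g w) (word_act u (word_act w v)))"
    by (simp add: sum_product mult_single rep_sum rep_single word_act_add)
  also have "\<dots> = (\<Sum>u\<in>?F. scale (?f u) (word_act u (rep g v)))"
  proof (intro sum.cong refl)
    fix u
    have "word_act u (rep g v) = (\<Sum>w\<in>?G. word_act u (scale (?g w) (word_act w v)))"
      unfolding rep_def
      by (intro endo_sum[OF endo_word_act subspace_V] subspace_scale[OF subspace_V]
        endo_closed[OF endo_word_act] v)
    also have "\<dots> = (\<Sum>w\<in>?G. scale (?g w) (word_act u (word_act w v)))"
      by (intro sum.cong refl endo_scale[OF endo_word_act] endo_closed[OF endo_word_act] v)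
    finally show "(\<Sum>w\<in>?G. scale (?f u * ?g w) (word_act u (word_act w v))) = scale (?f u) (word_act u (rep g v))"
      by (simp add: scale_sum_right)
  qed
  finally show ?thesis by (simp add: rep_def[of f])
qed

lemma rep_fgen: "rep (fgen g) v = act g v"
  by (simp add: fgen_def rep_single word_act_def)

lemma rep_fscalar: "rep (fscalar c) v = scale c v"
  by (simp add: fscalar_def rep_single word_act_def zero_list_def)

lemma rep_1: "rep 1 v = v"
  using rep_fscalar[of 1 v] by (simp add: fscalar_def)

lemma rep_power: "v \<in> V \<Longrightarrow> rep (f ^ k) v = (rep f ^^ k) v"
  by (induction k) (simp_all add: rep_1 rep_mult)

end

section \<open>Polynomials over an infinite field\<close>

lemma digit_sum_less:
  fixes m :: "nat \<Rightarrow> nat"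
  assumes "\<And>i. m i < B"
  shows "(\<Sum>i=1..d. m i * B ^ i) < B ^ Suc d"
proof (induction d)
  case 0
  then show ?case using assms[of 0] by simp
next
  case (Suc d)
  have "Suc (m (Suc d)) * B ^ Suc d \<le> B * B ^ Suc d"
    using assms[of "Suc d"] by (intro mult_right_mono) auto
  then show ?case using Suc by simp
qed

text \<open>Uniqueness of expansions in base \<open>B\<close>: by \<open>digit_sum_less\<close> the
  top digit is the quotient by the top power of \<open>B\<close>.\<close>

lemma digit_sum_inj:
  fixes m n :: "nat \<Rightarrow> nat"
  assumes "\<And>i. m i < B" "\<And>i. n i < B" "(\<Sum>i=1..d. m i * B ^ i) = (\<Sum>i=1..d. n i * B ^ i)"
    and "1 \<le> i" "i \<le> d"
  shows "m i = n i"
  using assms(3-)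
proof (induction d)
  case (Suc d)
  let ?s = "\<lambda>m. \<Sum>i=1..d. m i * B ^ i"
  have eq: "?s m + m (Suc d) * B ^ Suc d = ?s n + n (Suc d) * B ^ Suc d"
    using Suc.prems by simp
  have quot: "(s + q * P) div P = q" if "s < P" for s q P :: nat
    using that by simp
  have "m (Suc d) = (?s m + m (Suc d) * B ^ Suc d) div B ^ Suc d"
    by (rule quot[OF digit_sum_less[OF assms(1)], symmetric])
  also have "\<dots> = (?s n + n (Suc d) * B ^ Suc d) div B ^ Suc d" by (simp only: eq)
  also have "\<dots> = n (Suc d)" by (rule quot[OF digit_sum_less[OF assms(2)]])
  finally have "m (Suc d) = n (Suc d)" .
  then show ?case using Suc eq by (cases "i = Suc d") auto
qed simp

definition mpoly_eval :: "nat \<Rightarrow> ((nat \<Rightarrow>\<^sub>0 nat) \<Rightarrow>\<^sub>0 'k::field) \<Rightarrow> (nat \<Rightarrow> 'k) \<Rightarrow> 'k" where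
  "mpoly_eval d F x = (\<Sum>m\<in>Poly_Mapping.keys F. Poly_Mapping.lookup F m * (\<Prod>i=1..d. x i ^ Poly_Mapping.lookup m i))"

lemma mpoly_eval_superset:
  assumes "finite M" "Poly_Mapping.keys F \<subseteq> M"
  shows "mpoly_eval d F x = (\<Sum>m\<in>M. Poly_Mapping.lookup F m * (\<Prod>i=1..d. x i ^ Poly_Mapping.lookup m i))"
  unfolding mpoly_eval_def using assms by (intro sum.mono_neutral_left) (auto simp: in_keys_iff)

lemma mpoly_eval_add: "mpoly_eval d (F + G) x = mpoly_eval d F x + mpoly_eval d G x"
proof -
  let ?M = "Poly_Mapping.keys F \<union> Poly_Mapping.keys G"
  have "Poly_Mapping.keys (F + G) \<subseteq> ?M" by (rule Poly_Mapping.keys_add)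
  then show ?thesis
    by (simp add: mpoly_eval_superset[of ?M] lookup_add distrib_right sum.distrib)
qed

lemma mpoly_eval_sum: "mpoly_eval d (sum F X) x = (\<Sum>i\<in>X. mpoly_eval d (F i) x)"
  by (induction X rule: infinite_finite_induct) (auto simp: mpoly_eval_add mpoly_eval_def[of _ 0])

lemma mpoly_eval_single:
  "mpoly_eval d (Poly_Mapping.single m c) x = c * (\<Prod>i=1..d. x i ^ Poly_Mapping.lookup m i)"
  by (simp add: mpoly_eval_def)

lemma mpoly_eval_var:
  assumes "1 \<le> i" "i \<le> d"
  shows "mpoly_eval d (Poly_Mapping.single (Poly_Mapping.single i 1) c) x = c * x i"
proof -
  have "(\<Prod>j=1..d. x j ^ Poly_Mapping.lookup (Poly_Mapping.single i 1) j) = (\<Prod>j=1..d. if j = i then x j else 1)"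
    by (intro prod.cong) (auto simp: lookup_single when_def)
  then show ?thesis using assms by (simp add: mpoly_eval_single)
qed

text \<open>Kronecker substitution \<open>x\<^sub>i = t ^ (B ^ i)\<close> with \<open>B\<close> larger than every exponent.\<close>

lemma common_nonroot:
  fixes \<F> :: "((nat \<Rightarrow>\<^sub>0 nat) \<Rightarrow>\<^sub>0 'k::field) set"
  assumes inf: "infinite (UNIV :: 'k set)" and fin: "finite \<F>" and nz: "0 \<notin> \<F>"
    and vars: "\<And>F m. F \<in> \<F> \<Longrightarrow> m \<in> Poly_Mapping.keys F \<Longrightarrow> Poly_Mapping.keys m \<subseteq> {1..d}"
  obtains x where "\<And>F. F \<in> \<F> \<Longrightarrow> mpoly_eval d F x \<noteq> 0"
proof -
  define Ms where "Ms = (\<Union>F\<in>\<F>. Poly_Mapping.keys F)"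
  have finM: "finite Ms" using fin by (simp add: Ms_def)
  \<comment> \<open>The sum of all exponents in the finite family bounds each of them, and the
    successor makes the bound strict.\<close>
  define B where "B = Suc (\<Sum>m\<in>Ms. \<Sum>i\<in>Poly_Mapping.keys m. Poly_Mapping.lookup m i)"
  have bound: "Poly_Mapping.lookup m i < B" if "m \<in> Ms" for m i
  proof (cases "i \<in> Poly_Mapping.keys m")
    case True
    then have "Poly_Mapping.lookup m i \<le> (\<Sum>i\<in>Poly_Mapping.keys m. Poly_Mapping.lookup m i)"
      by (intro member_le_sum) auto
    also have "\<dots> \<le> (\<Sum>m\<in>Ms. \<Sum>i\<in>Poly_Mapping.keys m. Poly_Mapping.lookup m i)"
      by (rule member_le_sum[OF that]) (use finM in auto)
    finally show ?thesis by (simp add: B_def)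
  qed (simp add: B_def in_keys_iff)
  define w where "w = (\<lambda>m. \<Sum>i=1..d. Poly_Mapping.lookup m i * B ^ i)"
  \<comment> \<open>The univariate polynomial that results from the substitution. Distinct monomials
    of \<open>F\<close> get distinct exponents \<open>w m\<close>, so no coefficients merge.\<close>
  define kr where "kr = (\<lambda>F :: (nat \<Rightarrow>\<^sub>0 nat) \<Rightarrow>\<^sub>0 'k. \<Sum>m\<in>Poly_Mapping.keys F. Polynomial.monom (Poly_Mapping.lookup F m) (w m))"
  have inj: "m = n" if F: "F \<in> \<F>" "m \<in> Poly_Mapping.keys F" "n \<in> Poly_Mapping.keys F" "w m = w n" for F m n
  proof (rule poly_mapping_eqI)
    fix i
    have Ms: "m \<in> Ms" "n \<in> Ms" using F by (auto simp: Ms_def)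
    show "Poly_Mapping.lookup m i = Poly_Mapping.lookup n i"
    proof (cases "1 \<le> i \<and> i \<le> d")
      case True
      then show ?thesis
        using digit_sum_inj[of "Poly_Mapping.lookup m" B "Poly_Mapping.lookup n" d i] bound Ms F(4)
        by (simp add: w_def)
    next
      case False
      then have "i \<notin> Poly_Mapping.keys m" "i \<notin> Poly_Mapping.keys n"
        using vars[OF F(1,2)] vars[OF F(1,3)] by auto
      then show ?thesis by (simp add: in_keys_iff)
    qed
  qed
  have kr_nz: "kr F \<noteq> 0" if F: "F \<in> \<F>" for F
  proof -
    have "F \<noteq> 0" using F nz by auto
    then obtain n where n: "n \<in> Poly_Mapping.keys F" by fastforce
    have "coeff (kr F) (w n) = (\<Sum>m\<in>Poly_Mapping.keys F. if m = n then Poly_Mapping.lookup F m else 0)"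
      unfolding kr_def coeff_sum by (intro sum.cong) (use inj[OF F _ n] in auto)
    then have "coeff (kr F) (w n) = Poly_Mapping.lookup F n" using n by simp
    then show ?thesis using n by (auto simp: in_keys_iff)
  qed
  \<comment> \<open>One \<open>t\<close> serves all members: a nonroot of the product, available
    because the field is infinite.\<close>
  have "(\<Prod>F\<in>\<F>. kr F) \<noteq> 0" using kr_nz fin by simp
  then have "finite {t. poly (\<Prod>F\<in>\<F>. kr F) t = 0}" by (rule poly_roots_finite)
  then obtain t where t: "poly (\<Prod>F\<in>\<F>. kr F) t \<noteq> 0"
    using inf by (metis (mono_tags, lifting) UNIV_eq_I mem_Collect_eq)
  have "mpoly_eval d F (\<lambda>i. t ^ (B ^ i)) = poly (kr F) t" for F
    unfolding mpoly_eval_def kr_def w_def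
    by (simp add: poly_sum poly_monom power_sum mult.commute[of "Poly_Mapping.lookup _ _"] flip: power_mult)
  then show ?thesis
    using t fin that[of "\<lambda>i. t ^ (B ^ i)"] by (simp add: poly_prod)
qed

section \<open>From the free algebra to its quotient\<close>

lemma ring_monoid_algebra:
  fixes M :: "'m::monoid_add set"
  assumes "0 \<in> M" and closed: "\<And>u w. u \<in> M \<Longrightarrow> w \<in> M \<Longrightarrow> u + w \<in> M"
  shows "ring (monoid_algebra M :: ('k::field, 'm \<Rightarrow>\<^sub>0 'k) module)"
proof -
  have add: "Poly_Mapping.keys (f + g) \<subseteq> M" if "Poly_Mapping.keys f \<subseteq> M" "Poly_Mapping.keys g \<subseteq> M"
    for f g :: "'m \<Rightarrow>\<^sub>0 'k"
    using that Poly_Mapping.keys_add[of f g] by auto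
  have mult: "Poly_Mapping.keys (f * g) \<subseteq> M" if "Poly_Mapping.keys f \<subseteq> M" "Poly_Mapping.keys g \<subseteq> M"
    for f g :: "'m \<Rightarrow>\<^sub>0 'k"
    using that keys_mult[of f g] closed by blast
  show ?thesis
  proof (rule ringI)
    show "abelian_group (monoid_algebra M :: ('k, 'm \<Rightarrow>\<^sub>0 'k) module)"
    proof (rule abelian_groupI)
      fix f :: "'m \<Rightarrow>\<^sub>0 'k" assume "f \<in> carrier (monoid_algebra M)"
      then show "\<exists>g\<in>carrier (monoid_algebra M). g \<oplus>\<^bsub>monoid_algebra M\<^esub> f = \<zero>\<^bsub>monoid_algebra M\<^esub>"
        by (intro bexI[of _ "- f"]) (auto simp: monoid_algebra_def)
    qed (use add in \<open>auto simp: monoid_algebra_def algebra_simps\<close>)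
    show "Group.monoid (monoid_algebra M :: ('k, 'm \<Rightarrow>\<^sub>0 'k) module)"
      by (rule monoidI) (use mult assms(1) in \<open>auto simp: monoid_algebra_def mult.assoc\<close>)
  qed (auto simp: monoid_algebra_def algebra_simps)
qed

lemma single_0_central:
  fixes f :: "'m::monoid_add \<Rightarrow>\<^sub>0 'k::field"
  shows "Poly_Mapping.single 0 c * f = f * Poly_Mapping.single 0 c"
proof -
  have monomials: "Poly_Mapping.single 0 c * (\<Sum>m\<in>X. Poly_Mapping.single m (h m)) =
    (\<Sum>m\<in>X. Poly_Mapping.single m (h m)) * Poly_Mapping.single 0 c" for X and h :: "'m \<Rightarrow> 'k"
    by (simp add: sum_distrib_left sum_distrib_right mult_single mult.commute)
  show ?thesis
    using monomials[where X = "Poly_Mapping.keys f" and h = "Poly_Mapping.lookup f"]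
    by (simp only: flip: poly_mapping_monomials)
qed

text \<open>
  Adding to an ideal of \<open>K[M]\<close> all elements supported off \<open>M\<close> gives a two-sided ideal of the
  whole type, because a product of words lies in \<open>M\<close> only if both factors do. Computations modulo
  it need no carrier conditions.
\<close>

definition extended_ideal :: "'m set \<Rightarrow> ('m \<Rightarrow>\<^sub>0 'k::field) set \<Rightarrow> ('m \<Rightarrow>\<^sub>0 'k) set" where
  "extended_ideal M I = {x + y |x y. x \<in> I \<and> Poly_Mapping.keys y \<inter> M = {}}"

lemma extended_ideal:
  fixes M :: "'m::monoid_add set" and I :: "('m \<Rightarrow>\<^sub>0 'k::field) set"
  assumes I: "ideal I (monoid_algebra M)" and M: "0 \<in> M" "\<And>u w. u + w \<in> M \<longleftrightarrow> u \<in> M \<and> w \<in> M"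
  shows "two_sided_ideal (extended_ideal M I)"
    and "extended_ideal M I \<inter> carrier (monoid_algebra M) = I"
proof -
  define C where "C = carrier (monoid_algebra M :: ('k, 'm \<Rightarrow>\<^sub>0 'k) module)"
  define N where "N = {y :: 'm \<Rightarrow>\<^sub>0 'k. Poly_Mapping.keys y \<inter> M = {}}"
  have C: "C = {f. Poly_Mapping.keys f \<subseteq> M}" by (simp add: C_def monoid_algebra_def)
  have IC: "I \<subseteq> C"
    using additive_subgroup.a_subset[OF ideal.axioms(1)[OF I]] by (simp add: C_def)
  have I0: "0 \<in> I"
    using additive_subgroup.zero_closed[OF ideal.axioms(1)[OF I]] by (simp add: monoid_algebra_def)
  have Iadd: "x + y \<in> I" if "x \<in> I" "y \<in> I" for x y
    using additive_subgroup.a_closed[OF ideal.axioms(1)[OF I] that] by (simp add: monoid_algebra_def)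
  have Imult: "c * x \<in> I" "x * c \<in> I" if "x \<in> I" "c \<in> C" for x c
    using ideal.I_l_closed[OF I that(1), of c] ideal.I_r_closed[OF I that(1), of c] that(2)
    by (simp_all add: C_def) (simp_all add: monoid_algebra_def)
  have Idiff: "x - y \<in> I" if "x \<in> I" "y \<in> I" for x y
  proof -
    have "- 1 \<in> C" using M by (simp add: C)
    then show ?thesis using Iadd[OF that(1) Imult(1)[OF that(2)]] by fastforce
  qed
  have Nadd: "x + y \<in> N" "x - y \<in> N" if "x \<in> N" "y \<in> N" for x y
    using that Poly_Mapping.keys_add[of x y] keys_diff[of x y] by (auto simp: N_def)
  have Nmult: "r * y \<in> N" "y * r \<in> N" if "y \<in> N" for r y
    using that keys_mult[of r y] keys_mult[of y r] M(2) unfolding N_def by blast+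
  \<comment> \<open>Every element is a part supported on \<open>M\<close> plus a part supported off
    \<open>M\<close>. Multiplication by the first preserves \<open>I\<close>, and all products with
    a factor from \<open>N\<close> stay in \<open>N\<close>.\<close>
  have split: "\<exists>c\<in>C. \<exists>n\<in>N. f = c + n" for f
  proof -
    let ?s = "\<lambda>X. \<Sum>m\<in>X. Poly_Mapping.single m (Poly_Mapping.lookup f m)"
    have keys: "Poly_Mapping.keys (?s X) \<subseteq> X" for X
      using keys_sum[of "\<lambda>m. Poly_Mapping.single m (Poly_Mapping.lookup f m)" X] by (auto split: if_splits)
    have "f = ?s (Poly_Mapping.keys f \<inter> M \<union> (Poly_Mapping.keys f - M))"
      using poly_mapping_monomials[of f] by (simp add: Int_Diff_Un)
    also have "\<dots> = ?s (Poly_Mapping.keys f \<inter> M) + ?s (Poly_Mapping.keys f - M)"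
      by (rule sum.union_disjoint) auto
    finally have "f = ?s (Poly_Mapping.keys f \<inter> M) + ?s (Poly_Mapping.keys f - M)" .
    moreover have "?s (Poly_Mapping.keys f \<inter> M) \<in> C" "?s (Poly_Mapping.keys f - M) \<in> N"
      using keys[of "Poly_Mapping.keys f \<inter> M"] keys[of "Poly_Mapping.keys f - M"]
      unfolding C N_def by blast+
    ultimately show ?thesis by blast
  qed
  have J: "x \<in> extended_ideal M I \<longleftrightarrow> (\<exists>y\<in>I. \<exists>n\<in>N. x = y + n)" for x
    by (auto simp: extended_ideal_def N_def)
  have JI: "y + n \<in> extended_ideal M I" if "y \<in> I" "n \<in> N" for y n
    using that J by auto
  show "two_sided_ideal (extended_ideal M I)"
  proof
    show "0 \<in> extended_ideal M I" using JI[OF I0, of 0] by (simp add: N_def)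
  next
    fix x y assume "x \<in> extended_ideal M I" "y \<in> extended_ideal M I"
    then obtain u n v m where *: "u \<in> I" "n \<in> N" "x = u + n" "v \<in> I" "m \<in> N" "y = v + m"
      using J by metis
    have "x - y = (u - v) + (n - m)" using * by simp
    also have "\<dots> \<in> extended_ideal M I" by (intro JI Idiff Nadd *)
    finally show "x - y \<in> extended_ideal M I" .
  next
    fix x r assume "x \<in> extended_ideal M I"
    then obtain u n where x: "u \<in> I" "n \<in> N" "x = u + n" using J by metis
    obtain c m where r: "c \<in> C" "m \<in> N" "r = c + m" using split by metis
    have "r * x = c * u + (m * u + r * n)" "x * r = u * c + (u * m + n * r)"
      using x r by (simp_all add: algebra_simps)
    moreover have "c * u + (m * u + r * n) \<in> extended_ideal M I"
      "u * c + (u * m + n * r) \<in> extended_ideal M I"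
      by (intro JI Imult Nadd Nmult x r)+
    ultimately show "r * x \<in> extended_ideal M I" "x * r \<in> extended_ideal M I" by simp_all
  qed
  show "extended_ideal M I \<inter> carrier (monoid_algebra M) = I"
  proof
    show "extended_ideal M I \<inter> carrier (monoid_algebra M) \<subseteq> I"
    proof
      fix x assume x: "x \<in> extended_ideal M I \<inter> carrier (monoid_algebra M)"
      then obtain u n where u: "u \<in> I" "n \<in> N" "x = u + n" using J by blast
      \<comment> \<open>\<open>n\<close> is supported both on and off \<open>M\<close>, so it
        vanishes.\<close>
      have "n = x - u" using u by simp
      then have "Poly_Mapping.keys n \<subseteq> M"
        using keys_diff[of x u] x u(1) IC unfolding C_def[symmetric] by (auto simp: C)
      then have "Poly_Mapping.keys n = {}" using u(2) unfolding N_def by blast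
      then have "n = 0" by simp
      then show "x \<in> I" using u by simp
    qed
    show "I \<subseteq> extended_ideal M I \<inter> carrier (monoid_algebra M)"
      using JI[of _ 0] IC by (force simp: N_def C_def)
  qed
qed

section \<open>Representatives and cosets in the presented algebra\<close>

locale T_presentation =
  fixes d :: nat and \<theta> \<theta>s :: "nat \<Rightarrow> 'k::field"
  assumes distinct: "\<And>i j. i \<le> d \<Longrightarrow> j \<le> d \<Longrightarrow> i \<noteq> j \<Longrightarrow> \<theta> i \<noteq> \<theta> j \<and> \<theta>s i \<noteq> \<theta>s j"
begin

abbreviation "A \<equiv> free_algebra (gens d) :: ('k, gen list \<Rightarrow>\<^sub>0 'k) module"
abbreviation "I \<equiv> T_ideal d \<theta> \<theta>s"
abbreviation "T \<equiv> T_algebra d \<theta> \<theta>s"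

lemma A_simps:
  "carrier A = {f. Poly_Mapping.keys f \<subseteq> lists (gens d)}" "mult A = (*)" "one A = 1" "zero A = 0" "add A = (+)"
  "Module.smult A = (\<lambda>c f. fscalar c * f)"
  by (simp_all add: free_algebra_def monoid_algebra_def mult_map_scale_conv_mult fscalar_def)

lemma ring_A: "ring A"
  unfolding free_algebra_def by (rule ring_monoid_algebra) (auto simp: zero_list_def plus_list_def)

lemma A_closed [intro, simp]:
  "0 \<in> carrier A" "1 \<in> carrier A" "fscalar c \<in> carrier A"
  "f \<in> carrier A \<Longrightarrow> g \<in> carrier A \<Longrightarrow> f + g \<in> carrier A"
  "f \<in> carrier A \<Longrightarrow> g \<in> carrier A \<Longrightarrow> f - g \<in> carrier A"
  "f \<in> carrier A \<Longrightarrow> g \<in> carrier A \<Longrightarrow> f * g \<in> carrier A"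
proof -
  show "f + g \<in> carrier A" if "f \<in> carrier A" "g \<in> carrier A"
    using ring.ring_simprules(1)[OF ring_A that] by (simp add: A_simps(5))
  show "f * g \<in> carrier A" if "f \<in> carrier A" "g \<in> carrier A"
    using ring.ring_simprules(5)[OF ring_A that] by (simp add: A_simps(2))
  show "f - g \<in> carrier A" if "f \<in> carrier A" "g \<in> carrier A"
    using that keys_diff[of f g] by (auto simp: A_simps)
qed (auto simp: A_simps fscalar_def zero_list_def)

lemma A_sum [intro]: "(\<And>i. i \<in> X \<Longrightarrow> f i \<in> carrier A) \<Longrightarrow> sum f X \<in> carrier A"
  by (induction X rule: infinite_finite_induct) auto

lemma A_power [intro, simp]: "f \<in> carrier A \<Longrightarrow> f ^ n \<in> carrier A"
  by (induction n) auto

lemma A_fgen [intro, simp]: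
  "fgen Gen_a \<in> carrier A" "fgen Gen_as \<in> carrier A"
  "i \<le> d \<Longrightarrow> fgen (Gen_e i) \<in> carrier A" "i \<le> d \<Longrightarrow> fgen (Gen_es i) \<in> carrier A"
  by (simp_all add: A_simps fgen_def) (simp_all add: gens_def)

lemma relators_A: "T_relators d \<theta> \<theta>s \<subseteq> carrier A"
  unfolding T_relators_def by (auto intro!: A_sum)

lemma ideal_I: "ideal I A"
  unfolding T_ideal_def by (rule ring.genideal_ideal[OF ring_A relators_A])

lemma relators_I: "T_relators d \<theta> \<theta>s \<subseteq> I"
  unfolding T_ideal_def by (rule ring.genideal_self[OF ring_A relators_A])

definition J :: "(gen list \<Rightarrow>\<^sub>0 'k) set" where
  "J = extended_ideal (lists (gens d)) I"

lemma J_ideal: "two_sided_ideal J" and J_A: "J \<inter> carrier A = I"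
  using extended_ideal[of I "lists (gens d)"] ideal_I
  by (auto simp: J_def free_algebra_def zero_list_def plus_list_def)

lemma relators_J: "T_relators d \<theta> \<theta>s \<subseteq> J"
  using relators_I J_A by auto

sublocale rel: tridiagonal_relations J fscalar d \<theta> \<theta>s "fgen Gen_a" "fgen Gen_as"
  "\<lambda>i. fgen (Gen_e i)" "\<lambda>i. fgen (Gen_es i)"
proof -
  interpret two_sided_ideal J by (rule J_ideal)
  interpret scalar_ideal J fscalar
    by standard (simp_all add: fscalar_def single_add mult_single single_0_central)
  have R: "cong x y" if "x - y \<in> T_relators d \<theta> \<theta>s" for x y
    using that relators_J by (auto simp: cong_def)
  have R0: "cong x 0" if "x \<in> T_relators d \<theta> \<theta>s" for x
    using that R[of x 0] by simp
  show "tridiagonal_relations J fscalar d \<theta> \<theta>s (fgen Gen_a) (fgen Gen_as)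
    (\<lambda>i. fgen (Gen_e i)) (\<lambda>i. fgen (Gen_es i))"
  proof (intro tridiagonal_relations.intro)
    show "tridiagonal_action J fscalar d \<theta> (fgen Gen_a) (\<lambda>i. fgen (Gen_e i)) (\<lambda>i. fgen (Gen_es i))"
    proof
      show "inj_on \<theta> {..d}" using distinct by (auto simp: inj_on_def)
      fix i j k assume "i \<le> d" "j \<le> d"
      then show "cong (fgen (Gen_e i) * fgen (Gen_e j)) (if i = j then fgen (Gen_e i) else 0)"
        by (intro R) (auto simp: T_relators_def)
      assume "k \<le> d" "int k < \<bar>int i - int j\<bar>"
      then show "cong (fgen (Gen_es i) * fgen Gen_a ^ k * fgen (Gen_es j)) 0"
        using \<open>i \<le> d\<close> \<open>j \<le> d\<close> by (intro R0) (auto simp: T_relators_def)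
    qed (intro R; simp add: T_relators_def)+
    show "tridiagonal_action J fscalar d \<theta>s (fgen Gen_as) (\<lambda>i. fgen (Gen_es i)) (\<lambda>i. fgen (Gen_e i))"
    proof
      show "inj_on \<theta>s {..d}" using distinct by (auto simp: inj_on_def)
      fix i j k assume "i \<le> d" "j \<le> d"
      then show "cong (fgen (Gen_es i) * fgen (Gen_es j)) (if i = j then fgen (Gen_es i) else 0)"
        by (intro R) (auto simp: T_relators_def)
      assume "k \<le> d" "int k < \<bar>int i - int j\<bar>"
      then show "cong (fgen (Gen_e i) * fgen Gen_as ^ k * fgen (Gen_e j)) 0"
        using \<open>i \<le> d\<close> \<open>j \<le> d\<close> by (intro R0) (auto simp: T_relators_def)
    qed (intro R; simp add: T_relators_def)+
  qed
qed

notation rel.A.cong (infix \<open>\<approx>\<close> 50)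

definition coset :: "(gen list \<Rightarrow>\<^sub>0 'k) \<Rightarrow> (gen list \<Rightarrow>\<^sub>0 'k) set" where
  "coset f = I +>\<^bsub>A\<^esub> f"

text \<open>Within the carrier \<open>J\<close> coincides with \<open>I\<close>, so the congruence
  calculations modulo \<open>J\<close> become equations in the quotient.\<close>

lemma coset_eq_iff:
  assumes "f \<in> carrier A" "g \<in> carrier A"
  shows "coset f = coset g \<longleftrightarrow> f \<approx> g"
proof -
  interpret ring A by (rule ring_A)
  interpret ideal I A by (rule ideal_I)
  have minus: "f \<ominus>\<^bsub>A\<^esub> g = f - g"
  proof -
    have "(f \<ominus>\<^bsub>A\<^esub> g) \<oplus>\<^bsub>A\<^esub> g = f" using assms by algebra
    then show ?thesis by (simp add: A_simps eq_diff_eq)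
  qed
  have "coset f = coset g \<longleftrightarrow> f \<ominus>\<^bsub>A\<^esub> g \<in> I"
    unfolding coset_def using quotient_eq_iff_same_a_r_cos[OF ideal_I assms] by simp
  also have "\<dots> \<longleftrightarrow> f - g \<in> J" using J_A assms by (auto simp: minus)
  finally show ?thesis by (simp add: rel.A.cong_def)
qed

lemma T_simps:
  "carrier T = coset ` carrier A"
  "f \<in> carrier A \<Longrightarrow> g \<in> carrier A \<Longrightarrow> coset f \<otimes>\<^bsub>T\<^esub> coset g = coset (f * g)"
  "f \<in> carrier A \<Longrightarrow> g \<in> carrier A \<Longrightarrow> coset f \<oplus>\<^bsub>T\<^esub> coset g = coset (f + g)"
  "\<one>\<^bsub>T\<^esub> = coset 1"
  "f \<in> carrier A \<Longrightarrow> c \<odot>\<^bsub>T\<^esub> coset f = coset (fscalar c * f)"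
proof -
  interpret ring A by (rule ring_A)
  interpret ideal I A by (rule ideal_I)
  note T_defs = T_algebra_def quotient_algebra_def ring.extend_def FactRing_def
  show "carrier T = coset ` carrier A"
    by (auto simp: T_defs coset_def A_RCOSETS_def')
  show "coset f \<otimes>\<^bsub>T\<^esub> coset g = coset (f * g)" if "f \<in> carrier A" "g \<in> carrier A"
    using rcoset_mult_add[OF that] by (simp add: T_defs coset_def A_simps)
  show "coset f \<oplus>\<^bsub>T\<^esub> coset g = coset (f + g)" if "f \<in> carrier A" "g \<in> carrier A"
    using a_rcos_sum[OF that] by (simp add: T_defs coset_def A_simps)
  show "\<one>\<^bsub>T\<^esub> = coset 1" by (simp add: T_defs coset_def A_simps)
  show "c \<odot>\<^bsub>T\<^esub> coset f = coset (fscalar c * f)" if f: "f \<in> carrier A"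
  proof -
    \<comment> \<open>The scalar action is defined as a union over all representatives; it is a
      single coset because \<open>J\<close> absorbs multiples by scalars.\<close>
    have "coset (fscalar c * x) = coset (fscalar c * f)" if x: "x \<in> coset f" for x
    proof -
      obtain h where h: "h \<in> I" "x = h + f" using x by (auto simp: coset_def a_r_coset_def' A_simps)
      have "h \<in> carrier A" "h \<in> J" using h J_A by auto
      then show ?thesis
        using f h rel.A.mult_left[of h "fscalar c"]
        by (subst coset_eq_iff) (auto simp: rel.A.cong_def algebra_simps)
    qed
    moreover have "f \<in> coset f" unfolding coset_def by (rule a_rcos_self[OF f])
    ultimately have "(\<Union>x\<in>coset f. coset (fscalar c * x)) = coset (fscalar c * f)" by blast
    then show ?thesis by (simp add: T_defs coset_def A_simps(6))
  qed
qed

lemma algebra_eval_coset: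
  assumes f: "f \<in> carrier A"
  shows "algebra_eval T p (coset f) = coset (rel.A.ev p f)"
proof -
  interpret ring A by (rule ring_A)
  interpret ideal I A by (rule ideal_I)
  interpret Q: ring "A Quot I" by (rule quotient_is_ring)
  have parts: "carrier T = carrier (A Quot I)" "add T = add (A Quot I)" "zero T = zero (A Quot I)"
    by (simp_all add: T_algebra_def quotient_algebra_def ring.extend_def)
  \<comment> \<open>\<open>T\<close> has the carrier and addition of \<open>A Quot I\<close>, so
    sums can be computed in that ring.\<close>
  have finsum: "finsum T h X = finsum (A Quot I) h X" for h and X :: "nat set"
    by (simp add: finsum_def finprod_def parts)
  have power: "coset f [^]\<^bsub>T\<^esub> (n::nat) = coset (f ^ n)" for n
  proof (induction n)
    case 0
    then show ?case by (simp add: nat_pow_def T_simps(4))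
  next
    case (Suc n)
    have "coset f [^]\<^bsub>T\<^esub> Suc n = coset f [^]\<^bsub>T\<^esub> n \<otimes>\<^bsub>T\<^esub> coset f" by (simp add: nat_pow_def)
    then show ?case using Suc T_simps(2)[of "f ^ n" f] f by (simp add: power_Suc2 del: power_Suc)
  qed
  have sum: "finsum (A Quot I) (\<lambda>i. coset (h i)) {..n} = coset (\<Sum>i\<le>n. h i)"
    if h: "\<And>i. h i \<in> carrier A" for h and n :: nat
  proof (induction n)
    case 0
    have "coset (h 0) \<in> carrier (A Quot I)" using T_simps(1) h by (auto simp: parts)
    then show ?case by simp
  next
    case (Suc n)
    have "(\<lambda>i. coset (h i)) \<in> {..Suc n} \<rightarrow> carrier (A Quot I)"
      using T_simps(1) h by (auto simp: parts)
    then show ?case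
      using Suc T_simps(3)[of "h (Suc n)" "\<Sum>i\<le>n. h i"] h
      by (simp add: Q.finsum_Suc parts(2)[symmetric] add.commute A_sum)
  qed
  show ?thesis
    using sum[of "\<lambda>i. fscalar (coeff p i) * f ^ i" "degree p"] f
    by (simp add: algebra_eval_def rel.A.ev_def power T_simps(5) finsum)
qed

end

section \<open>The homomorphism from the polynomial algebra\<close>

context T_presentation
begin

abbreviation es0 :: "gen list \<Rightarrow>\<^sub>0 'k" where
  "es0 \<equiv> fgen (Gen_es 0)"

lemma polys_carrier: "rel.polys = carrier (poly_algebra {1..d})"
  by (simp add: rel.polys_def poly_algebra_def monoid_algebra_def)

lemma ev_A [intro, simp]: "f \<in> carrier A \<Longrightarrow> rel.A.ev p f \<in> carrier A"
  unfolding rel.A.ev_def by (auto intro!: A_sum)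

lemma corner_gen_A [intro, simp]: "rel.corner_gen r \<in> carrier A"
  unfolding rel.corner_gen_def by (intro A_closed ev_A) auto

lemma mon_A [intro, simp]: "rel.mon m \<in> carrier A"
proof -
  have "rel.mon_upto k m \<in> carrier A" for k by (induction k) auto
  then show ?thesis by (simp add: rel.mon_def)
qed

lemma Phi_A [intro, simp]: "rel.Phi F \<in> carrier A"
  unfolding rel.Phi_def by (auto intro!: A_sum)

text \<open>\<open>es0\<close> is \<open>Phi 1\<close>, hence modulo \<open>J\<close> a two-sided
  identity for the values of \<open>Phi\<close>.\<close>

lemma Phi_corner: "es0 * rel.Phi F * es0 \<approx> rel.Phi F"
proof -
  have "rel.Phi F \<approx> rel.Phi 1 * rel.Phi F" using rel.Phi_mult[of 1 F] by simp
  then have left: "rel.Phi F \<approx> es0 * rel.Phi F" by (simp add: rel.Phi_1)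
  have "rel.Phi F \<approx> rel.Phi F * rel.Phi 1" using rel.Phi_mult[of F 1] by simp
  then have right: "rel.Phi F \<approx> rel.Phi F * es0" by (simp add: rel.Phi_1)
  have "rel.Phi F \<approx> es0 * rel.Phi F * es0"
    by (rule rel.A.cong_trans[OF right rel.A.cong_mult[OF left rel.A.cong_refl]])
  then show ?thesis by (rule rel.A.cong_sym)
qed

lemma single_word: "Poly_Mapping.single w (c :: 'k) = fscalar c * prod_list (map fgen w)"
proof -
  have "prod_list (map fgen w) = (Poly_Mapping.single w 1 :: gen list \<Rightarrow>\<^sub>0 'k)"
  proof (induction w)
    case Nil
    have "Poly_Mapping.single ([] :: gen list) (1 :: 'k) = 1" by (simp flip: zero_list_def)
    then show ?case by simp
  qed (simp add: fgen_def mult_single plus_list_def)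
  then show ?thesis by (simp add: fscalar_def mult_single)
qed

lemma corner_surjective:
  assumes f: "f \<in> carrier A"
  shows "\<exists>F\<in>rel.polys. es0 * f * es0 \<approx> rel.Phi F"
proof -
  have "es0 * Poly_Mapping.single w c * es0 \<in> rel.Phi_range"
    if w: "w \<in> Poly_Mapping.keys f" for w and c :: 'k
  proof -
    have "set w \<subseteq> gens d" using f w by (auto simp: A_simps)
    then have "set (map fgen w :: (gen list \<Rightarrow>\<^sub>0 'k) list) \<subseteq> {fgen Gen_a, fgen Gen_as} \<union>
        (\<lambda>i. fgen (Gen_e i)) ` {..d} \<union> (\<lambda>i. fgen (Gen_es i)) ` {..d}"
      by (auto simp: gens_def)
    then have "es0 * prod_list (map fgen w) * es0 \<in> rel.Phi_range"
      by (rule rel.corner_generated[OF rel.corner_closed_Phi_range])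
    then have "fscalar c * (es0 * prod_list (map fgen w) * es0) \<in> rel.Phi_range"
      by (rule rel.A.vs.subspace_scale[OF rel.subspace_Phi_range(1)])
    then show ?thesis
      by (simp add: single_word mult.assoc rel.A.sc_left_commute[of es0])
  qed
  then have "(\<Sum>w\<in>Poly_Mapping.keys f. es0 * Poly_Mapping.single w (Poly_Mapping.lookup f w) * es0) \<in> rel.Phi_range"
    by (intro rel.A.vs.subspace_sum[OF rel.subspace_Phi_range(1)])
  moreover have "(\<Sum>w\<in>Poly_Mapping.keys f. es0 * Poly_Mapping.single w (Poly_Mapping.lookup f w) * es0) =
    es0 * (\<Sum>w\<in>Poly_Mapping.keys f. Poly_Mapping.single w (Poly_Mapping.lookup f w)) * es0"
    by (simp add: sum_distrib_left sum_distrib_right)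
  ultimately show ?thesis
    unfolding poly_mapping_monomials[of f, symmetric] rel.Phi_range_def by simp
qed

section \<open>Injectivity from sharp tridiagonal systems\<close>

lemma eigenvalues_nonzero: "1 \<le> h \<Longrightarrow> h \<le> d \<Longrightarrow> \<theta>s 0 - \<theta>s h \<noteq> 0"
  using distinct[of 0 h] by simp

text \<open>For \<open>i \<le> d\<close> the roots of these polynomials have indices from 1 to
  \<open>d\<close>.\<close>

lemma poly_eta_nonzero: "poly (eta d \<theta> i) (\<theta> 0) * poly (eta d \<theta>s i) (\<theta>s 0) \<noteq> 0" if "i \<le> d"
proof -
  have "\<theta> 0 \<noteq> \<theta> (d - h) \<and> \<theta>s 0 \<noteq> \<theta>s (d - h)" if "h < i" for h
    using distinct[of 0 "d - h"] that \<open>i \<le> d\<close> by auto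
  then show ?thesis by (auto simp: eta_def poly_prod)
qed

text \<open>The system makes \<open>V\<close> a module over the presented algebra. By the split
  sequence, a nonzero \<open>v\<close> with \<open>Es 0 v = v\<close> is a common eigenvector of the
  \<open>corner_gen i\<close> with eigenvalues \<open>x i\<close>, so \<open>Phi F\<close>
  multiplies it by the value of \<open>F\<close> at \<open>x\<close>.\<close>

lemma sharp_system_eval:
  assumes sys: "exists_sharp_tridiagonal_system d \<theta> \<theta>s \<zeta>"
    and x: "\<And>i. 1 \<le> i \<Longrightarrow> i \<le> d \<Longrightarrow> x i = \<zeta> i / (\<Prod>h=1..i. \<theta>s 0 - \<theta>s h)"
    and F: "rel.Phi F \<in> I"
  shows "mpoly_eval d F x = 0"
proof -
  obtain V L E Ls Es where ts: "seq.tridiagonal_system V d L E Ls Es"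
    and pa: "seq.parameter_array V d L E Ls Es \<theta> \<theta>s \<zeta>"
    using sys by (auto simp: exists_sharp_tridiagonal_system_def)
  have V: "seq.subspace V" and L: "seq.endo V L" and Ls: "seq.endo V Ls"
    and diag: "seq.diagonalizable V L" "seq.diagonalizable V Ls"
    and idem: "seq.standard_idempotents V L Ls d E" "seq.standard_idempotents V Ls L d Es"
    using ts by (auto simp: seq.tridiagonal_system_def seq.tridiagonal_pair_def)
  have ev: "seq.eigenvalue_sequence V d L E \<theta>" "seq.eigenvalue_sequence V d Ls Es \<theta>s"
    and split: "seq.split_sequence V d L Es \<theta> \<theta>s \<zeta>"
    using pa by (auto simp: seq.parameter_array_def)
  note E = seq.standard_idempotents_relations[OF V L Ls diag(1) idem(1) ev(1)]
  note Es = seq.standard_idempotents_relations[OF V Ls L diag(2) idem(2) ev(2)]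
  \<comment> \<open>Indices above \<open>d\<close> lie outside the presentation; the identity is a
    default that keeps \<open>act g\<close> an endomorphism for every \<open>g\<close>.\<close>
  define act where "act = (\<lambda>g. case g of Gen_a \<Rightarrow> L | Gen_e i \<Rightarrow> if i \<le> d then E i else id
    | Gen_as \<Rightarrow> Ls | Gen_es i \<Rightarrow> if i \<le> d then Es i else id)"
  have act [simp]: "act Gen_a = L" "act Gen_as = Ls" "i \<le> d \<Longrightarrow> act (Gen_e i) = E i"
    "i \<le> d \<Longrightarrow> act (Gen_es i) = Es i" for i
    by (simp_all add: act_def)
  have "seq.endo V (act g)" for g
    using E(1) Es(1) L Ls by (cases g) (auto simp: act_def seq.endo_def)
  then interpret word_action seq_scale V act
    by unfold_locales (use V in auto)
  note rep_simps = rep_mult rep_fgen rep_diff rep_add rep_sum rep_fscalar rep_1 rep_power rep_closed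
  have rep_power_gen: "rep (fgen g ^ k) v = (act g ^^ k) v" if "v \<in> V" for g k v
    using rep_power[OF that, of "fgen g" k] by (simp add: rep_fgen[abs_def])
  \<comment> \<open>The elements acting as zero form an ideal, so only the relators have to be
    checked.\<close>
  have "I \<subseteq> {f \<in> carrier A. \<forall>v\<in>V. rep f v = 0}"
    unfolding T_ideal_def
  proof (rule ring.genideal_minimal[OF ring_A])
    show "ideal {f \<in> carrier A. \<forall>v\<in>V. rep f v = 0} A"
    proof (rule idealI[OF ring_A])
      show "subgroup {f \<in> carrier A. \<forall>v\<in>V. rep f v = 0} (add_monoid A)"
      proof (rule group.subgroupI)
        show "Group.group (add_monoid A)"
          using ring.is_abelian_group[OF ring_A] abelian_group.a_group by blast
        show "{f \<in> carrier A. \<forall>v\<in>V. rep f v = 0} \<noteq> {}" by (auto intro: exI[of _ 0])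
      next
        fix f assume f: "f \<in> {f \<in> carrier A. \<forall>v\<in>V. rep f v = 0}"
        have "inv\<^bsub>add_monoid A\<^esub> f = 0 - f"
        proof -
          interpret ring A by (rule ring_A)
          have "\<ominus>\<^bsub>A\<^esub> f \<oplus>\<^bsub>A\<^esub> f = \<zero>\<^bsub>A\<^esub>" using f by (intro l_neg) auto
          then have "\<ominus>\<^bsub>A\<^esub> f = 0 - f" by (simp add: A_simps eq_neg_iff_add_eq_0)
          then show ?thesis by (simp add: a_inv_def)
        qed
        then show "inv\<^bsub>add_monoid A\<^esub> f \<in> {f \<in> carrier A. \<forall>v\<in>V. rep f v = 0}"
          using f A_closed(5)[of 0 f] by (simp add: rep_diff del: diff_0)
      qed (auto simp: A_simps(5) rep_add)
    qed (auto simp: A_simps(2) rep_mult rep_closed seq.endo_0[OF endo_rep V])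
    have "rep f v = 0" if f: "f \<in> T_relators d \<theta> \<theta>s" and v: "v \<in> V" for f v
    proof -
      have scaled: "rep (fscalar c * fgen g) v = seq_scale c (act g v)" for c g
        using v by (simp add: rep_simps)
      show ?thesis
        using f E(2-5)[where v = v] Es(2-5)[where v = v] v unfolding T_relators_def
        by (auto simp: rep_mult rep_fgen rep_diff rep_sum rep_1 rep_power_gen scaled rep_closed
          seq.endo_closed[OF E(1)] seq.endo_closed[OF Es(1)])
    qed
    then show "T_relators d \<theta> \<theta>s \<subseteq> {f \<in> carrier A. \<forall>v\<in>V. rep f v = 0}"
      using relators_A by auto
  qed
  then have Phi0: "rep (rel.Phi F) v = 0" if "v \<in> V" for v using F that by auto
  obtain v where v: "v \<in> V" "v \<noteq> 0" "Es 0 v = v" using Es(6)[of 0] by auto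
  have gen: "rep (rel.corner_gen i) v = seq_scale (x i) v" if "1 \<le> i" "i \<le> d" for i
  proof -
    have "rep (rel.A.ev p (fgen Gen_a)) v = seq.poly_op p L v" for p
      unfolding rel.A.ev_def seq.poly_op_def
      using v by (simp add: rep_sum rep_mult rep_closed rep_fscalar rep_power_gen)
    then have "rep (rel.corner_gen i) v = Es 0 (seq.poly_op (tau \<theta> i) L (Es 0 v))"
      using v by (simp add: rel.corner_gen_def rep_mult rep_fgen rep_closed)
    then show ?thesis
      using split[unfolded seq.split_sequence_def, rule_format, of i v] that x[OF that] v by simp
  qed
  have gen_power: "rep (rel.corner_gen i ^ n) v = seq_scale (x i ^ n) v" if "1 \<le> i" "i \<le> d" for i n
  proof (induction n)
    case (Suc n)
    have "rep (rel.corner_gen i ^ Suc n) v = rep (rel.corner_gen i) (seq_scale (x i ^ n) v)"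
      using Suc v by (simp add: rep_mult)
    also have "\<dots> = seq_scale (x i ^ n) (rep (rel.corner_gen i) v)"
      by (rule seq.endo_scale[OF endo_rep v(1)])
    also have "\<dots> = seq_scale (x i ^ Suc n) v"
      by (simp add: gen[OF that] mult.commute)
    finally show ?case .
  qed (simp add: rep_1)
  have "rep (rel.mon_upto k m) v = seq_scale (\<Prod>i=1..k. x i ^ Poly_Mapping.lookup m i) v" if "k \<le> d" for k m
    using that
  proof (induction k)
    case (Suc k)
    have "rep (rel.mon_upto (Suc k) m) v = rep (rel.mon_upto k m) (seq_scale (x (Suc k) ^ Poly_Mapping.lookup m (Suc k)) v)"
      using gen_power[of "Suc k"] Suc.prems v by (simp add: rep_mult)
    also have "\<dots> = seq_scale (x (Suc k) ^ Poly_Mapping.lookup m (Suc k)) (rep (rel.mon_upto k m) v)"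
      by (rule seq.endo_scale[OF endo_rep v(1)])
    finally show ?case using Suc by (simp add: mult.commute)
  qed (simp add: rep_1)
  then have "rep (rel.mon m) v = seq_scale (\<Prod>i=1..d. x i ^ Poly_Mapping.lookup m i) v" for m
    using v seq.endo_scale[OF Es(1)[of 0] v(1)] by (simp add: rel.mon_def rep_mult rep_fgen)
  then have "rep (rel.Phi F) v = seq_scale (mpoly_eval d F x) v"
    using v by (simp add: rel.Phi_def mpoly_eval_def rep_sum rep_mult rep_fscalar seq.scale_sum_left)
  then show ?thesis using Phi0[OF v(1)] v(2) by simp
qed

text \<open>In the coordinates \<open>x i = \<zeta> i / c i\<close>, admissibility of
  \<open>\<zeta>\<close> is the nonvanishing of two polynomials. A point where these and a nonzero
  \<open>F\<close> are all nonzero contradicts \<open>sharp_system_eval\<close>.\<close>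

lemma Phi_injective:
  assumes inf: "infinite (UNIV :: 'k set)"
    and sys: "\<And>\<zeta> :: nat \<Rightarrow> 'k. \<zeta> 0 = 1 \<Longrightarrow> \<zeta> d \<noteq> 0 \<Longrightarrow>
      0 \<noteq> (\<Sum>i=0..d. poly (eta d \<theta> (d - i)) (\<theta> 0) * poly (eta d \<theta>s (d - i)) (\<theta>s 0) * \<zeta> i) \<Longrightarrow>
      exists_sharp_tridiagonal_system d \<theta> \<theta>s \<zeta>"
    and F: "F \<in> rel.polys" "rel.Phi F \<in> I"
  shows "F = 0"
proof (rule ccontr)
  assume "F \<noteq> 0"
  define \<kappa> where "\<kappa> = (\<lambda>i. poly (eta d \<theta> (d - i)) (\<theta> 0) * poly (eta d \<theta>s (d - i)) (\<theta>s 0))"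
  define c where "c = (\<lambda>i. \<Prod>h=1..i. \<theta>s 0 - \<theta>s h)"
  have c_nz: "c i \<noteq> 0" if "i \<le> d" for i
    using eigenvalues_nonzero that by (auto simp: c_def)
  let ?X = "\<lambda>i c. Poly_Mapping.single (Poly_Mapping.single i 1) c :: (nat \<Rightarrow>\<^sub>0 nat) \<Rightarrow>\<^sub>0 'k"
  \<comment> \<open>The sum in the admissibility condition, rewritten with
    \<open>\<zeta> 0 = 1\<close> and \<open>\<zeta> i = c i * x i\<close>. Its constant term
    \<open>\<kappa> 0\<close> is nonzero, hence so is \<open>G\<close>.\<close>
  define G where "G = Poly_Mapping.single 0 (\<kappa> 0) + (\<Sum>i=1..d. ?X i (\<kappa> i * c i))"
  \<comment> \<open>The third polynomial ensures \<open>\<zeta> d \<noteq> 0\<close>. For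
    \<open>d = 0\<close> there is no variable and \<open>\<zeta> d = 1\<close>, so the constant 1
    takes its place.\<close>
  define \<F> where "\<F> = {F, G, if d = 0 then 1 else ?X d 1}"
  have "Poly_Mapping.lookup G 0 = \<kappa> 0"
  proof -
    have "Poly_Mapping.single i (1::nat) \<noteq> 0" for i :: nat
      by (metis keys_single keys_zero insert_not_empty one_neq_zero)
    then show ?thesis by (simp add: G_def lookup_add lookup_sum lookup_single_not_eq)
  qed
  then have "G \<noteq> 0" using poly_eta_nonzero[of d] by (auto simp: \<kappa>_def)
  moreover have "?X d 1 \<noteq> 0"
    by (metis keys_single keys_zero insert_not_empty one_neq_zero)
  ultimately have nz: "0 \<notin> \<F>" using \<open>F \<noteq> 0\<close> by (auto simp: \<F>_def)
  have G_keys: "Poly_Mapping.keys G \<subseteq> insert 0 ((\<lambda>i. Poly_Mapping.single i 1) ` {1..d})"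
    using Poly_Mapping.keys_add[of "Poly_Mapping.single 0 (\<kappa> 0)" "\<Sum>i=1..d. ?X i (\<kappa> i * c i)"]
      keys_sum[of "\<lambda>i. ?X i (\<kappa> i * c i)" "{1..d}"]
    by (fastforce simp: G_def split: if_splits)
  have vars: "Poly_Mapping.keys m \<subseteq> {1..d}" if "H \<in> \<F>" "m \<in> Poly_Mapping.keys H" for H m
    using that F(1) G_keys by (auto simp: \<F>_def rel.polys_def split: if_splits)
  have "finite \<F>" by (simp add: \<F>_def)
  then obtain x where x: "\<And>H. H \<in> \<F> \<Longrightarrow> mpoly_eval d H x \<noteq> 0"
    using common_nonroot[OF inf _ nz, of d] vars by blast
  define \<zeta> where "\<zeta> = (\<lambda>i. if i = 0 then 1 else c i * x i)"
  have "exists_sharp_tridiagonal_system d \<theta> \<theta>s \<zeta>"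
  proof (rule sys)
    show "\<zeta> d \<noteq> 0"
      using x[of "?X d 1"] c_nz[of d] mpoly_eval_var[of d d 1 x] by (auto simp: \<F>_def \<zeta>_def)
    have "(\<Sum>i=0..d. \<kappa> i * \<zeta> i) = \<kappa> 0 + (\<Sum>i=1..d. \<kappa> i * c i * x i)"
      by (simp add: sum.atLeast_Suc_atMost \<zeta>_def mult.assoc)
    also have "\<dots> = mpoly_eval d G x"
      by (simp add: G_def mpoly_eval_add mpoly_eval_sum mpoly_eval_single[of _ 0] mpoly_eval_var
        del: One_nat_def)
    finally show "0 \<noteq> (\<Sum>i=0..d. poly (eta d \<theta> (d - i)) (\<theta> 0) * poly (eta d \<theta>s (d - i)) (\<theta>s 0) * \<zeta> i)"
      using x[of G] by (simp add: \<F>_def \<kappa>_def)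
  qed (simp add: \<zeta>_def)
  then have "mpoly_eval d F x = 0"
  proof (rule sharp_system_eval[OF _ _ F(2)])
    show "x i = \<zeta> i / (\<Prod>h=1..i. \<theta>s 0 - \<theta>s h)" if "1 \<le> i" "i \<le> d" for i
      using c_nz[OF that(2)] that(1) unfolding c_def \<zeta>_def by simp
  qed
  then show False using x[of F] by (simp add: \<F>_def)
qed

section \<open>The isomorphism onto the corner algebra\<close>

definition mu :: "((nat \<Rightarrow>\<^sub>0 nat) \<Rightarrow>\<^sub>0 'k) \<Rightarrow> (gen list \<Rightarrow>\<^sub>0 'k) set" where
  "mu F = coset (rel.Phi F)"

abbreviation "corner \<equiv> corner_algebra T (T_gen d \<theta> \<theta>s (Gen_es 0))"

lemma T_gen_coset: "T_gen d \<theta> \<theta>s g = coset (fgen g)"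
  by (simp add: T_gen_def coset_def)

lemma corner_simps:
  "carrier corner = (\<lambda>f. coset (es0 * f * es0)) ` carrier A"
  "mult corner = mult T" "add corner = add T" "one corner = coset es0" "Module.smult corner = Module.smult T"
proof -
  have "T_gen d \<theta> \<theta>s (Gen_es 0) \<otimes>\<^bsub>T\<^esub> coset f \<otimes>\<^bsub>T\<^esub> T_gen d \<theta> \<theta>s (Gen_es 0) = coset (es0 * f * es0)"
    if "f \<in> carrier A" for f
    using that by (simp add: T_gen_coset T_simps)
  then show "carrier corner = (\<lambda>f. coset (es0 * f * es0)) ` carrier A"
    by (auto simp: corner_algebra_def T_simps(1))
qed (simp_all add: corner_algebra_def T_gen_coset)

lemma mu_hom: "mu \<in> algebra_hom (poly_algebra {1..d}) corner"
proof -
  have coset_cong: "coset f = coset g" if "f \<in> carrier A" "g \<in> carrier A" "f \<approx> g" for f g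
    using coset_eq_iff that by simp
  have "mu F \<in> carrier corner" for F
  proof -
    have "mu F = coset (es0 * rel.Phi F * es0)"
      unfolding mu_def by (rule coset_cong[OF _ _ rel.A.cong_sym[OF Phi_corner]]) auto
    then show ?thesis unfolding corner_simps by (rule image_eqI) simp
  qed
  moreover have "mu (F * G) = mu F \<otimes>\<^bsub>T\<^esub> mu G" "mu (F + G) = mu F \<oplus>\<^bsub>T\<^esub> mu G" for F G
    by (simp_all add: mu_def T_simps rel.Phi_add coset_cong[OF _ _ rel.Phi_mult])
  moreover have "mu 1 = coset es0" by (simp add: mu_def rel.Phi_1)
  moreover have "mu (Poly_Mapping.map ((*) c) F) = c \<odot>\<^bsub>T\<^esub> mu F" for c F
    using coset_cong[OF _ _ rel.Phi_scale[of c F]]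
    by (simp add: mu_def T_simps mult_map_scale_conv_mult)
  ultimately show ?thesis
    by (auto simp: algebra_hom_def ring_hom_def corner_simps poly_algebra_def monoid_algebra_def)
qed

theorem mu_iso:
  assumes "infinite (UNIV :: 'k set)"
    and "\<And>\<zeta> :: nat \<Rightarrow> 'k. \<zeta> 0 = 1 \<Longrightarrow> \<zeta> d \<noteq> 0 \<Longrightarrow>
      0 \<noteq> (\<Sum>i=0..d. poly (eta d \<theta> (d - i)) (\<theta> 0) * poly (eta d \<theta>s (d - i)) (\<theta>s 0) * \<zeta> i) \<Longrightarrow>
      exists_sharp_tridiagonal_system d \<theta> \<theta>s \<zeta>"
  shows "mu \<in> algebra_iso (poly_algebra {1..d}) corner"
proof -
  have "inj_on mu rel.polys"
  proof (rule inj_onI)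
    fix F G assume FG: "F \<in> rel.polys" "G \<in> rel.polys" "mu F = mu G"
    have minus: "F - G \<in> rel.polys" using FG keys_diff[of F G] by (auto simp: rel.polys_def)
    have "rel.Phi F \<approx> rel.Phi G" using FG(3) by (simp add: mu_def coset_eq_iff)
    \<comment> \<open>\<open>Phi\<close> is exactly additive, so equality of two images passes to
      the difference, to which \<open>Phi_injective\<close> applies.\<close>
    moreover have "rel.Phi F = rel.Phi (F - G) + rel.Phi G"
      using rel.Phi_add[of "F - G" G] by simp
    ultimately have "rel.Phi (F - G) \<in> I"
      using J_A Phi_A[of "F - G"] by (auto simp: rel.A.cong_def)
    then have "F - G = 0" using Phi_injective[OF assms minus] by simp
    then show "F = G" by simp
  qed
  moreover have "mu ` rel.polys = carrier corner"
  proof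
    show "mu ` rel.polys \<subseteq> carrier corner"
      using mu_hom by (auto simp: algebra_hom_def ring_hom_def polys_carrier)
    show "carrier corner \<subseteq> mu ` rel.polys"
    proof
      fix X assume "X \<in> carrier corner"
      then obtain f where f: "f \<in> carrier A" "X = coset (es0 * f * es0)"
        by (auto simp: corner_simps)
      obtain F where F: "F \<in> rel.polys" "es0 * f * es0 \<approx> rel.Phi F"
        using corner_surjective[OF f(1)] by blast
      have "X = mu F" using F f by (simp add: mu_def coset_eq_iff)
      then show "X \<in> mu ` rel.polys" using F by blast
    qed
  qed
  ultimately show ?thesis
    using mu_hom by (auto simp: algebra_iso_def bij_betw_def polys_carrier)
qed

lemma mu_var:
  assumes "i \<in> {1..d}"
  shows "mu (poly_var i) = T_gen d \<theta> \<theta>s (Gen_es 0) \<otimes>\<^bsub>T\<^esub>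
    algebra_eval T (tau \<theta> i) (T_gen d \<theta> \<theta>s Gen_a) \<otimes>\<^bsub>T\<^esub> T_gen d \<theta> \<theta>s (Gen_es 0)"
proof -
  have "rel.Phi (poly_var i) \<approx> rel.corner_gen i"
    using rel.mon_single[of i] assms by (simp add: poly_var_def rel.Phi_single)
  then have "mu (poly_var i) = coset (rel.corner_gen i)" by (simp add: mu_def coset_eq_iff)
  then show ?thesis
    by (simp add: T_gen_coset algebra_eval_coset T_simps rel.corner_gen_def)
qed

end

theorem theorem5p1:
  fixes d :: nat and \<theta> \<theta>s :: "nat \<Rightarrow> 'k::field"
  assumes "infinite (UNIV :: 'k set)"
    and "\<And>i j. i \<le> d \<Longrightarrow> j \<le> d \<Longrightarrow> i \<noteq> j \<Longrightarrow> \<theta> i \<noteq> \<theta> j \<and> \<theta>s i \<noteq> \<theta>s j"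
    and "\<exists>c. \<forall>i. 2 \<le> i \<and> i + 1 \<le> d \<longrightarrow>
           (\<theta> (i - 2) - \<theta> (i + 1)) / (\<theta> (i - 1) - \<theta> i) = c \<and>
           (\<theta>s (i - 2) - \<theta>s (i + 1)) / (\<theta>s (i - 1) - \<theta>s i) = c"
    and "\<And>\<zeta> :: nat \<Rightarrow> 'k. \<zeta> 0 = 1 \<Longrightarrow> \<zeta> d \<noteq> 0 \<Longrightarrow>
           0 \<noteq> (\<Sum>i=0..d. poly (eta d \<theta> (d - i)) (\<theta> 0) * poly (eta d \<theta>s (d - i)) (\<theta>s 0) * \<zeta> i) \<Longrightarrow>
           exists_sharp_tridiagonal_system d \<theta> \<theta>s \<zeta>"
  shows "let T = T_algebra d \<theta> \<theta>s; a = T_gen d \<theta> \<theta>s Gen_a; es0 = T_gen d \<theta> \<theta>s (Gen_es 0) in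
           \<exists>\<mu> \<in> algebra_iso (poly_algebra {1..d}) (corner_algebra T es0).
             \<forall>i\<in>{1..d}. \<mu> (poly_var i) = es0 \<otimes>\<^bsub>T\<^esub> algebra_eval T (tau \<theta> i) a \<otimes>\<^bsub>T\<^esub> es0"
proof -
  interpret T_presentation d \<theta> \<theta>s by (rule T_presentation.intro) (rule assms(2))
  show ?thesis
    unfolding Let_def by (intro bexI[of _ mu] ballI mu_var mu_iso[OF assms(1,4)])
qed

end
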